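(* Let $F$ be a surface of genus $g\ge0$ with $s\ge1$ punctures, $2g-2+s>0$, let $\tau\subset F$ be a trivalent fatgraph of $F$, and let $\tau'$ be the flip of $\tau$ at an edge. Label and orient the edges where the flip occurs as follows: in $\tau$, edges $3$ and $4$ end at a vertex $u$, edge $5$ (the edge being flipped) goes from $u$ to a vertex $v$, and edges $1$ and $2$ start at $v$; in $\tau'$, edge $3$ ends at $u'$ and edge $2$ starts at $u'$, edge $4$ ends at $v'$ and edge $1$ starts at $v'$, and the new edge $5$ goes from $u'$ to $v'$. Let $o$, $o'$ be orientations of $\tau$, $\tau'$ that are as described on these edges and agree on all others. Let $\vec c\in\tilde C(F,o,\tau)$ have coordinates $(a_i,b_i;\alpha_i,\beta_i)$, $i=1,\dots,5$, on the edges where the flip occurs, and let $\vec{c'}$ be the corresponding element in $\tilde C(F,o',\tau')$ modulo gauge equivalences, i.e. the image of $\vec c$ under the flip. Then there is a choice of representative $\vec{c'}$ which agrees with $\vec c$ on all edges not involved in the flip and whose coordinates on edges $1,\dots,5$ are respectively $$(a_1',b_1;\alpha_1,\beta_1'),\quad (a_2',b_2b_5;\alpha_2,\beta_2'),\quad (a_3',b_3;\alpha_3',\beta_3),\quad (a_4',b_4b_5;\alpha_4',\beta_4),\quad (a_5',b_5;0,0),$$ where $$\beta_1'=\beta_1+b_5^2\beta_5,\quad \beta_2'=\beta_5+b_5^{-2}\beta_2,\quad \alpha_3'=\alpha_3+b_5^2\alpha_5,\quad \alpha_4'=b_5^{-2}\alpha_4+\alpha_5,$$ $$a_1'=a_1\left(1-\tfrac12b_1^2b_5^2\alpha_1\beta_5\right),\quad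 a_3'=a_3\left(1-\tfrac12b_3^2b_5^2\alpha_5\beta_3\right),\quad a_5'=a_5\left(1-\tfrac12b_5^2\alpha_5\beta_5\right),$$ $$a_2'=a_2a_5\left(1-\tfrac12b_2^2b_5^2\alpha_2\beta_5\right)\left(1-\tfrac12b_5^2\alpha_5\beta_5\right),\quad a_4'=a_4a_5\left(1-\tfrac12b_4^2b_5^2\alpha_5\beta_4\right)\left(1-\tfrac12b_5^2\alpha_5\beta_5\right).$$
   Context: Grassmann algebra: fix $N$ and let $\mathbb{R}^{S[N]}=\mathbb{R}^{S[N]}_0\oplus\mathbb{R}^{S[N]}_1$ be the real Grassmann algebra on $N$ anticommuting generators, with its even/odd decomposition. The body of an element is its coefficient of $1$; "positive" for an even element means its body is positive. Even elements are denoted by Latin letters, odd elements by Greek letters. $GL(1|1)$ denotes the (identity component) group of supermatrices $\begin{pmatrix} a&\alpha\\ \beta&b\end{pmatrix}$ with $a,b\in\mathbb{R}^{S[N]}_0$ of positive body and $\alpha,\beta\in\mathbb{R}^{S[N]}_1$, with the multiplication $$\begin{pmatrix} a&\alpha\\ \beta&b\end{pmatrix}\begin{pmatrix} c&\gamma\\ \delta&d\end{pmatrix}=\begin{pmatrix} ac-\alpha\delta& a\gamma+d\alpha\\ c\beta+d\delta& bd-\beta\gamma\end{pmatrix}.$$ Every element is uniquely of the form $$g(a,b;\alpha,\beta)=a\left(1+\tfrac12 b^2\alpha\beta\right)\begin{pmatrix}1&\alpha\\0&1\end{pmatrix}\begin{pmatrix}b^{-1}&0\\0&b\end{pmatrix}\begin{pmatrix}1&0\\\beta&1\end{pmatrix}$$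 with $a,b$ even of positive body and $\alpha,\beta$ odd. A fatgraph is a graph with a cyclic ordering of the edges at each vertex; a fatgraph of $F$ is one whose fattening is $F$. A $G$-graph connection on $\tau$ assigns to each oriented edge $e$ an element $g_e\in G$ with $g_{\bar e}=g_e^{-1}$ for the reversed edge $\bar e$. Two graph connections are gauge equivalent if there are $h_v\in G$ for all vertices $v$ with $\tilde g_e=h_v^{-1}g_eh_{v'}$ whenever $e$ starts at $v'$ and ends at $v$. The monodromy along a path traversing oriented edges $e_1,\dots,e_k$ in this order is $g_{e_k}\cdots g_{e_1}$. Gauge equivalence classes of $G$-graph connections on $\tau$ are identified with $\mathrm{Hom}(\pi_1(F),G)/G$ via monodromies along cycles. $\tilde C(F,o,\tau)$ is the set of assignments to each edge of $\tau$, oriented by $o$, of a tuple $(a,b;\alpha,\beta)$ with $a,b$ even positive and $\alpha,\beta$ odd; it represents the $GL(1|1)$-graph connection with value $g(a,b;\alpha,\beta)$ on that oriented edge. Gauge equivalence of coordinate vectors means gauge equivalence of the graph connections they represent. The flip shrinks the edge $5$ joining $u$ to $v$ and then extends a new edge $5$ joining $u'$ to $v'$; the rest of the graph is unchanged. A cycle of $\tau$ is carried to a cycle of $\tau'$ by replacing each passage through the flip region as follows, where paths are written with the first edge traversed on the right, $e$ denotes edge $5$ of $\tau$ and $f$ edge $5$ of $\tau'$ (inverse passages are replaced by inverse passages): $1\,e\,3\mapsto 1\,f\,3$, $\;2\,e\,4\mapsto 2\,f^{-1}4$, $\;1\,e\,4\mapsto 1\,4$, $\;4^{-1}3\mapsto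 4^{-1}f\,3$, $\;2\,e\,3\mapsto 2\,3$, $\;1\,2^{-1}\mapsto 1\,f\,2^{-1}$. The image of (the class of) a graph connection on $\tau$ under the flip is the gauge equivalence class of graph connections on $\tau'$ with the same monodromies along corresponding cycles (i.e. the same element of $\mathrm{Hom}(\pi_1(F),G)/G$).
   Formalization: The edges 1,…,5 are assumed pairwise distinct (if two coincide, the listed coordinates contradict each other, e.g. 1=3 forces β_5=0), and the lower-left entry of the GL(1|1) product is corrected from cβ+dδ to cβ+bδ, since the printed product has no unit. *)

theory Defs
  imports Complex_Main "HOL-Algebra.Group" "HOL-Combinatorics.Orbits"
begin

section \<open>Real Grassmann algebras\<close>

text \<open>
  An element is the family of its coefficients with respect to the monomials
  \<open>\<theta>\<^sub>S = \<theta>\<^sub>i\<^sub>1 \<cdots> \<theta>\<^sub>i\<^sub>k\<close> for \<open>S = {i\<^sub>1 < \<dots> < i\<^sub>k}\<close>, a finite set of naturals.  The type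
  is only an ambient ring with countably many generators \<open>\<theta>\<^sub>0, \<theta>\<^sub>1, \<dots>\<close>; the real Grassmann
  algebra on \<open>N\<close> generators is the subalgebra of elements supported on subsets of \<open>{..<N}\<close>.
\<close>

typedef grassmann = "{f :: nat set \<Rightarrow> real. \<forall>S. infinite S \<longrightarrow> f S = 0}"
  morphisms coeff Abs_grassmann
  by (rule exI[of _ "\<lambda>_. 0"]) simp

setup_lifting type_definition_grassmann

text \<open>\<open>\<theta>\<^sub>S \<theta>\<^sub>T = shuffle_sign S T \<theta>\<^sub>S\<^sub>\<union>\<^sub>T\<close> for disjoint \<open>S\<close> and \<open>T\<close>, the exponent being the number of
  transpositions that sort the product.\<close>

definition shuffle_sign :: "nat set \<Rightarrow> nat set \<Rightarrow> real" where
  "shuffle_sign S T = (- 1) ^ card {(i, j). i \<in> S \<and> j \<in> T \<and> j < i}"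

lemma shuffle_sign_empty [simp]: "shuffle_sign {} S = 1" "shuffle_sign S {} = 1"
  by (simp_all add: shuffle_sign_def)

lemma finite_inversions:
  assumes "finite S" "finite T"
  shows "finite {(i, j). i \<in> S \<and> j \<in> T \<and> j < (i::nat)}"
  by (rule finite_subset[of _ "S \<times> T"]) (use assms in auto)

lemma shuffle_sign_Un_left:
  assumes "finite A" "finite B" "finite C" "A \<inter> B = {}"
  shows "shuffle_sign (A \<union> B) C = shuffle_sign A C * shuffle_sign B C"
proof -
  have "{(i, j). i \<in> A \<union> B \<and> j \<in> C \<and> j < i} =
      {(i, j). i \<in> A \<and> j \<in> C \<and> j < i} \<union> {(i, j). i \<in> B \<and> j \<in> C \<and> j < i}"
    by auto
  moreover have "{(i, j). i \<in> A \<and> j \<in> C \<and> j < i} \<inter> {(i, j). i \<in> B \<and> j \<in> C \<and> j < i} = {}"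
    using assms by auto
  ultimately show ?thesis
    by (simp add: shuffle_sign_def card_Un_disjoint finite_inversions assms power_add)
qed

lemma shuffle_sign_Un_right:
  assumes "finite A" "finite B" "finite C" "B \<inter> C = {}"
  shows "shuffle_sign A (B \<union> C) = shuffle_sign A B * shuffle_sign A C"
proof -
  have "{(i, j). i \<in> A \<and> j \<in> B \<union> C \<and> j < i} =
      {(i, j). i \<in> A \<and> j \<in> B \<and> j < i} \<union> {(i, j). i \<in> A \<and> j \<in> C \<and> j < i}"
    by auto
  moreover have "{(i, j). i \<in> A \<and> j \<in> B \<and> j < i} \<inter> {(i, j). i \<in> A \<and> j \<in> C \<and> j < i} = {}"
    using assms by auto
  ultimately show ?thesis
    by (simp add: shuffle_sign_def card_Un_disjoint finite_inversions assms power_add)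
qed

instantiation grassmann :: real_algebra_1
begin

lift_definition zero_grassmann :: grassmann is "\<lambda>_. 0" by simp

lift_definition one_grassmann :: grassmann is "\<lambda>S. if S = {} then 1 else 0" by auto

lift_definition plus_grassmann :: "grassmann \<Rightarrow> grassmann \<Rightarrow> grassmann"
  is "\<lambda>x y S. x S + y S" by simp

lift_definition minus_grassmann :: "grassmann \<Rightarrow> grassmann \<Rightarrow> grassmann"
  is "\<lambda>x y S. x S - y S" by simp

lift_definition uminus_grassmann :: "grassmann \<Rightarrow> grassmann" is "\<lambda>x S. - x S" by simp

lift_definition scaleR_grassmann :: "real \<Rightarrow> grassmann \<Rightarrow> grassmann"
  is "\<lambda>r x S. r * x S" by simp

lift_definition times_grassmann :: "grassmann \<Rightarrow> grassmann \<Rightarrow> grassmann"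
  is "\<lambda>x y U. \<Sum>S\<in>Pow U. shuffle_sign S (U - S) * x S * y (U - S)"
  by simp

lemma grassmann_mult_assoc: "x * y * z = x * (y * z)" for x y z :: grassmann
proof (transfer, rule ext)
  fix x y z :: "nat set \<Rightarrow> real" and U :: "nat set"
  let ?s = shuffle_sign
  show "(\<Sum>S\<in>Pow U. ?s S (U - S) * (\<Sum>T\<in>Pow S. ?s T (S - T) * x T * y (S - T)) * z (U - S)) =
        (\<Sum>T\<in>Pow U. ?s T (U - T) * x T *
          (\<Sum>R\<in>Pow (U - T). ?s R (U - T - R) * y R * z (U - T - R)))"
  proof (cases "finite U")
    case True
    have "(\<Sum>S\<in>Pow U. ?s S (U - S) * (\<Sum>T\<in>Pow S. ?s T (S - T) * x T * y (S - T)) * z (U - S)) =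
        (\<Sum>(S, T)\<in>Sigma (Pow U) Pow. ?s S (U - S) * (?s T (S - T) * x T * y (S - T)) * z (U - S))"
      using True by (subst sum.Sigma[symmetric])
        (auto simp: sum_distrib_left sum_distrib_right intro: finite_subset)
    also have "\<dots> = (\<Sum>(T, R)\<in>Sigma (Pow U) (\<lambda>T. Pow (U - T)).
        ?s T (U - T) * x T * (?s R (U - T - R) * y R * z (U - T - R)))"
    proof (rule sum.reindex_bij_witness
        [of _ "\<lambda>(T, R). (T \<union> R, T)" "\<lambda>(S, T). (T, S - T)"], goal_cases)
      case (5 p)
      then obtain S T where p: "p = (S, T)" "T \<subseteq> S" "S \<subseteq> U" by auto
      define R C where "R = S - T" and "C = U - S"
      have S: "S = T \<union> R" and UT: "U - T = R \<union> C" "U - T - R = C"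
        and dis: "T \<inter> R = {}" "R \<inter> C = {}"
        using p by (auto simp: R_def C_def)
      have fin: "finite T" "finite R" "finite C"
        using True p by (auto simp: R_def C_def intro: finite_subset)
      have "?s (T \<union> R) C * ?s T R = ?s T (R \<union> C) * ?s R C"
        using fin dis by (simp add: shuffle_sign_Un_left shuffle_sign_Un_right)
      then have "?s S (U - S) * ?s T (S - T) = ?s T (U - T) * ?s R C"
        by (simp add: S[symmetric] UT R_def[symmetric] C_def[symmetric])
      then have "?s S (U - S) * ?s T (S - T) * (x T * y R * z C) =
          ?s T (U - T) * ?s R C * (x T * y R * z C)"
        by (rule arg_cong)
      then show ?case
        unfolding p(1) prod.case R_def[symmetric] C_def[symmetric] UT(2)
        by (simp only: ac_simps)
    qed auto
    also have "\<dots> = (\<Sum>T\<in>Pow U. ?s T (U - T) * x T *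
          (\<Sum>R\<in>Pow (U - T). ?s R (U - T - R) * y R * z (U - T - R)))"
      using True by (subst sum.Sigma[symmetric]) (auto simp: sum_distrib_left)
    finally show ?thesis .
  qed (simp add: finite_Pow_iff)
qed

instance
proof
  fix x y z :: grassmann and r s :: real
  show "x * y * z = x * (y * z)" by (rule grassmann_mult_assoc)
  show "(x + y) * z = x * z + y * z"
    by transfer (simp add: algebra_simps sum.distrib)
  show "x * (y + z) = x * y + x * z"
    by transfer (simp add: algebra_simps sum.distrib)
  show "1 * x = x"
  proof (transfer, rule ext)
    fix x :: "nat set \<Rightarrow> real" and U :: "nat set"
    assume x: "\<forall>S. infinite S \<longrightarrow> x S = 0"
    show "(\<Sum>S\<in>Pow U. shuffle_sign S (U - S) * (if S = {} then 1 else 0) * x (U - S)) = x U"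
    proof (cases "finite U")
      case True
      then show ?thesis by (subst sum.remove[of _ "{}"]) (auto intro!: sum.neutral)
    qed (use x in \<open>simp add: finite_Pow_iff\<close>)
  qed
  show "x * 1 = x"
  proof (transfer, rule ext)
    fix x :: "nat set \<Rightarrow> real" and U :: "nat set"
    assume x: "\<forall>S. infinite S \<longrightarrow> x S = 0"
    show "(\<Sum>S\<in>Pow U. shuffle_sign S (U - S) * x S * (if U - S = {} then 1 else 0)) = x U"
    proof (cases "finite U")
      case True
      then show ?thesis by (subst sum.remove[of _ U]) (auto intro!: sum.neutral split: if_splits)
    qed (use x in \<open>simp add: finite_Pow_iff\<close>)
  qed
  show "r *\<^sub>R x * y = r *\<^sub>R (x * y)"
    by transfer (simp add: algebra_simps sum_distrib_left)
  show "x * r *\<^sub>R y = r *\<^sub>R (x * y)"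
    by transfer (simp add: algebra_simps sum_distrib_left)
  show "(0::grassmann) \<noteq> 1"
    by transfer (auto simp: fun_eq_iff)
qed (transfer; simp add: algebra_simps fun_eq_iff)+

end

text \<open>Unspecified on non-units; the units are the elements with nonzero body.\<close>

instantiation grassmann :: inverse
begin

definition inverse_grassmann :: "grassmann \<Rightarrow> grassmann" where
  "inverse (x :: grassmann) = (THE y. x * y = 1 \<and> y * x = 1)"

definition divide_grassmann :: "grassmann \<Rightarrow> grassmann \<Rightarrow> grassmann" where
  "divide_grassmann x y = x * inverse y"

instance ..

end

definition body :: "grassmann \<Rightarrow> real" where
  "body x = coeff x {}"

definition grassmann_even :: "nat \<Rightarrow> grassmann set" where
  "grassmann_even N = {x. \<forall>S. coeff x S \<noteq> 0 \<longrightarrow> S \<subseteq> {..<N} \<and> even (card S)}"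

definition grassmann_odd :: "nat \<Rightarrow> grassmann set" where
  "grassmann_odd N = {x. \<forall>S. coeff x S \<noteq> 0 \<longrightarrow> S \<subseteq> {..<N} \<and> odd (card S)}"

definition grassmann_pos :: "nat \<Rightarrow> grassmann set" where
  "grassmann_pos N = {x \<in> grassmann_even N. 0 < body x}"


section \<open>The supergroup GL(1|1)\<close>

datatype supermatrix = SMat grassmann grassmann grassmann grassmann

text \<open>\<open>SMat a \<alpha> \<beta> b\<close> is the matrix with rows \<open>(a, \<alpha>)\<close> and \<open>(\<beta>, b)\<close>.  The signs in the product
  come from moving the odd matrix units past the odd entries.\<close>

fun smat_mult :: "supermatrix \<Rightarrow> supermatrix \<Rightarrow> supermatrix" where
  "smat_mult (SMat a \<alpha> \<beta> b) (SMat c \<gamma> \<delta> d) =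
     SMat (a * c - \<alpha> * \<delta>) (a * \<gamma> + d * \<alpha>) (c * \<beta> + b * \<delta>) (b * d - \<beta> * \<gamma>)"

fun smat_scale :: "grassmann \<Rightarrow> supermatrix \<Rightarrow> supermatrix" where
  "smat_scale x (SMat a \<alpha> \<beta> b) = SMat (x * a) (x * \<alpha>) (x * \<beta>) (x * b)"

definition GL11 :: "nat \<Rightarrow> supermatrix monoid" where
  "GL11 N = \<lparr>carrier = {SMat a \<alpha> \<beta> b | a \<alpha> \<beta> b.
        a \<in> grassmann_pos N \<and> b \<in> grassmann_pos N \<and>
        \<alpha> \<in> grassmann_odd N \<and> \<beta> \<in> grassmann_odd N},
     monoid.mult = smat_mult, one = SMat 1 0 0 1\<rparr>"

text \<open>A coordinate tuple \<open>(a, b; \<alpha>, \<beta>)\<close> is encoded as \<open>(a, b, \<alpha>, \<beta>)\<close>.\<close>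

type_synonym coord = "grassmann \<times> grassmann \<times> grassmann \<times> grassmann"

definition coords :: "nat \<Rightarrow> coord set" where
  "coords N = grassmann_pos N \<times> grassmann_pos N \<times> grassmann_odd N \<times> grassmann_odd N"

fun coord_elem :: "coord \<Rightarrow> supermatrix" where
  "coord_elem (a, b, \<alpha>, \<beta>) =
     smat_scale (a * (1 + (1/2) *\<^sub>R (b\<^sup>2 * \<alpha> * \<beta>)))
       (smat_mult (smat_mult (SMat 1 \<alpha> 0 1) (SMat (inverse b) 0 0 b)) (SMat 1 0 \<beta> 1))"


section \<open>Fatgraphs\<close>

text \<open>
  An edge \<open>e\<close> has the two oriented versions \<open>(e, True)\<close> and \<open>(e, False)\<close>.  An oriented edge is
  also regarded as a half-edge at the vertex where it starts, and \<open>nxt\<close> is the cyclic ordering of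
  the half-edges at each vertex.  Loops and multiple edges are allowed.
\<close>

type_synonym 'e oedge = "'e \<times> bool"

record ('v, 'e) fatgraph =
  verts :: "'v set"
  edges :: "'e set"
  source :: "'e oedge \<Rightarrow> 'v"
  nxt :: "'e oedge \<Rightarrow> 'e oedge"

definition rev_edge :: "'e oedge \<Rightarrow> 'e oedge" where
  "rev_edge d = (fst d, \<not> snd d)"

definition oedges :: "('v, 'e) fatgraph \<Rightarrow> 'e oedge set" where
  "oedges \<tau> = edges \<tau> \<times> UNIV"

definition target :: "('v, 'e) fatgraph \<Rightarrow> 'e oedge \<Rightarrow> 'v" where
  "target \<tau> d = source \<tau> (rev_edge d)"

definition star :: "('v, 'e) fatgraph \<Rightarrow> 'v \<Rightarrow> 'e oedge set" where
  "star \<tau> v = {d \<in> oedges \<tau>. source \<tau> d = v}"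

text \<open>Paths list the oriented edges in the order in which they are traversed.\<close>

fun is_path :: "('v, 'e) fatgraph \<Rightarrow> 'v \<Rightarrow> 'e oedge list \<Rightarrow> 'v \<Rightarrow> bool" where
  "is_path \<tau> x [] y \<longleftrightarrow> x \<in> verts \<tau> \<and> x = y"
| "is_path \<tau> x (d # p) y \<longleftrightarrow> d \<in> oedges \<tau> \<and> source \<tau> d = x \<and> is_path \<tau> (target \<tau> d) p y"

text \<open>The last condition says that \<open>nxt\<close> permutes the half-edges at each vertex in a single cycle.\<close>

definition fatgraph :: "('v, 'e) fatgraph \<Rightarrow> bool" where
  "fatgraph \<tau> \<longleftrightarrow> finite (verts \<tau>) \<and> finite (edges \<tau>) \<and> verts \<tau> \<noteq> {} \<and>
     source \<tau> ` oedges \<tau> \<subseteq> verts \<tau> \<and>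
     (\<forall>x\<in>verts \<tau>. \<forall>y\<in>verts \<tau>. \<exists>p. is_path \<tau> x p y) \<and>
     (\<forall>d\<in>oedges \<tau>. orbit (nxt \<tau>) d = star \<tau> (source \<tau> d))"

definition trivalent :: "('v, 'e) fatgraph \<Rightarrow> bool" where
  "trivalent \<tau> \<longleftrightarrow> (\<forall>v\<in>verts \<tau>. card (star \<tau> v) = 3)"

text \<open>Following the boundary of the fattening, one runs along an oriented edge to its end and
  continues along the next half-edge there.\<close>

definition boundary_cycles :: "('v, 'e) fatgraph \<Rightarrow> 'e oedge set set" where
  "boundary_cycles \<tau> = orbit (\<lambda>d. nxt \<tau> (rev_edge d)) ` oedges \<tau>"

text \<open>The fattening is a connected oriented surface that retracts to \<open>\<tau>\<close> and has one puncture for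
  each boundary cycle, so it is determined by the number of punctures and by its Euler
  characteristic \<open>2 - 2g - s\<close>, which is the one of \<open>\<tau>\<close>.\<close>

definition fatgraph_of_surface :: "nat \<Rightarrow> nat \<Rightarrow> ('v, 'e) fatgraph \<Rightarrow> bool" where
  "fatgraph_of_surface g s \<tau> \<longleftrightarrow> fatgraph \<tau> \<and> card (boundary_cycles \<tau>) = s \<and>
     int (card (verts \<tau>)) - int (card (edges \<tau>)) = 2 - 2 * int g - int s"

text \<open>
  Let \<open>x\<close> and \<open>y\<close> be the two half-edges of the edge \<open>e\<close>, with cyclic orderings \<open>(x, A, B)\<close> and
  \<open>(y, C, D)\<close> at its ends.  Shrinking \<open>e\<close> gives a four-valent vertex with cyclic ordering
  \<open>(A, B, C, D)\<close>.  It is split the other way, into vertices \<open>p\<close> and \<open>q\<close> with cyclic orderings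
  \<open>(x', D, A)\<close> and \<open>(y', B, C)\<close>, where \<open>x'\<close> and \<open>y'\<close> are the half-edges of the new edge.  The new
  edge is again called \<open>e\<close>, and either of its half-edges may be the one at \<open>p\<close>.
\<close>

definition is_flip :: "('v, 'e) fatgraph \<Rightarrow> 'e \<Rightarrow> ('v, 'e) fatgraph \<Rightarrow> bool" where
  "is_flip \<tau> e \<tau>' \<longleftrightarrow> e \<in> edges \<tau> \<and>
     (let x = (e, True); y = (e, False);
          A = nxt \<tau> x; B = nxt \<tau> A; C = nxt \<tau> y; D = nxt \<tau> C;
          V = verts \<tau> - {source \<tau> x, source \<tau> y}
      in source \<tau> x \<noteq> source \<tau> y \<and> edges \<tau>' = edges \<tau> \<and>
         (\<exists>p q x' y'. {x', y'} = {x, y} \<and> p \<noteq> q \<and> p \<notin> V \<and> q \<notin> V \<and> verts \<tau>' = V \<union> {p, q} \<and>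
            source \<tau>' x' = p \<and> source \<tau>' D = p \<and> source \<tau>' A = p \<and>
            nxt \<tau>' x' = D \<and> nxt \<tau>' D = A \<and> nxt \<tau>' A = x' \<and>
            source \<tau>' y' = q \<and> source \<tau>' B = q \<and> source \<tau>' C = q \<and>
            nxt \<tau>' y' = B \<and> nxt \<tau>' B = C \<and> nxt \<tau>' C = y') \<and>
         (\<forall>d\<in>oedges \<tau> - {x, y, A, B, C, D}. source \<tau>' d = source \<tau> d \<and> nxt \<tau>' d = nxt \<tau> d))"


section \<open>Graph connections\<close>

definition graph_connection ::
    "('g, 'm) monoid_scheme \<Rightarrow> ('v, 'e) fatgraph \<Rightarrow> ('e oedge \<Rightarrow> 'g) \<Rightarrow> bool" where
  "graph_connection G \<tau> A \<longleftrightarrow>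
     (\<forall>d\<in>oedges \<tau>. A d \<in> carrier G \<and> A (rev_edge d) = inv\<^bsub>G\<^esub> (A d))"

definition gauge_equivalent ::
    "('g, 'm) monoid_scheme \<Rightarrow> ('v, 'e) fatgraph \<Rightarrow> ('e oedge \<Rightarrow> 'g) \<Rightarrow> ('e oedge \<Rightarrow> 'g) \<Rightarrow> bool"
  where
  "gauge_equivalent G \<tau> A B \<longleftrightarrow> (\<exists>h\<in>verts \<tau> \<rightarrow> carrier G. \<forall>d\<in>oedges \<tau>.
     B d = inv\<^bsub>G\<^esub> (h (target \<tau> d)) \<otimes>\<^bsub>G\<^esub> A d \<otimes>\<^bsub>G\<^esub> h (source \<tau> d))"

definition gauge_class ::
    "('g, 'm) monoid_scheme \<Rightarrow> ('v, 'e) fatgraph \<Rightarrow> ('e oedge \<Rightarrow> 'g) \<Rightarrow> ('e oedge \<Rightarrow> 'g) set"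
  where
  "gauge_class G \<tau> A = {B. graph_connection G \<tau> B \<and> gauge_equivalent G \<tau> A B}"

text \<open>Along the path \<open>e\<^sub>1, \<dots>, e\<^sub>k\<close> this is \<open>A e\<^sub>k \<cdots> A e\<^sub>1\<close>.\<close>

fun monodromy :: "('g, 'm) monoid_scheme \<Rightarrow> ('e oedge \<Rightarrow> 'g) \<Rightarrow> 'e oedge list \<Rightarrow> 'g" where
  "monodromy G A [] = \<one>\<^bsub>G\<^esub>"
| "monodromy G A (d # p) = monodromy G A p \<otimes>\<^bsub>G\<^esub> A d"

text \<open>An orientation \<open>\<omega>\<close> selects the oriented version \<open>(e, \<omega> e)\<close> of each edge \<open>e\<close>.\<close>

definition coord_vectors :: "nat \<Rightarrow> ('v, 'e) fatgraph \<Rightarrow> ('e \<Rightarrow> coord) set" where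
  "coord_vectors N \<tau> = edges \<tau> \<rightarrow> coords N"

fun coord_connection :: "nat \<Rightarrow> ('e \<Rightarrow> bool) \<Rightarrow> ('e \<Rightarrow> coord) \<Rightarrow> 'e oedge \<Rightarrow> supermatrix" where
  "coord_connection N \<omega> c (e, b) =
     (if b = \<omega> e then coord_elem (c e) else inv\<^bsub>GL11 N\<^esub> (coord_elem (c e)))"


section \<open>The action of a flip on cycles and on graph connections\<close>

text \<open>
  The passages through the flip region, with first components in \<open>\<tau>\<close> and second components in
  \<open>\<tau>'\<close>.  The arguments are the oriented edges 1, 2, 3, 4, the oriented edge \<open>e\<close> (edge 5 of \<open>\<tau>\<close>)
  and the oriented edge \<open>f\<close> (edge 5 of \<open>\<tau>'\<close>).  Paths are lists in order of traversal, hence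
  read in the opposite direction to the products of monodromies.
\<close>

definition passages ::
    "'e oedge \<Rightarrow> 'e oedge \<Rightarrow> 'e oedge \<Rightarrow> 'e oedge \<Rightarrow> 'e oedge \<Rightarrow> 'e oedge \<Rightarrow>
     ('e oedge list \<times> 'e oedge list) set" where
  "passages d1 d2 d3 d4 e f =
     {([d3, e, d1], [d3, f, d1]),
      ([d4, e, d2], [d4, rev_edge f, d2]),
      ([d4, e, d1], [d4, d1]),
      ([d3, rev_edge d4], [d3, f, rev_edge d4]),
      ([d3, e, d2], [d3, d2]),
      ([rev_edge d2, d1], [rev_edge d2, f, d1])}"

definition reverse_path :: "'e oedge list \<Rightarrow> 'e oedge list" where
  "reverse_path p = rev (map rev_edge p)"

text \<open>\<open>flip_path P R\<close> relates a path of \<open>\<tau>\<close> to its image in \<open>\<tau>'\<close>, for paths starting and ending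
  outside the flip region, where \<open>P\<close> are the passages and \<open>R\<close> the edges of the flip region.
  Every path without backtracking has an image; others need not.\<close>

inductive flip_path ::
    "('e oedge list \<times> 'e oedge list) set \<Rightarrow> 'e set \<Rightarrow> 'e oedge list \<Rightarrow> 'e oedge list \<Rightarrow> bool"
  for P R where
  nil: "flip_path P R [] []"
| outside: "fst d \<notin> R \<Longrightarrow> flip_path P R p p' \<Longrightarrow> flip_path P R (d # p) (d # p')"
| passage: "(r, r') \<in> P \<Longrightarrow> flip_path P R p p' \<Longrightarrow> flip_path P R (r @ p) (r' @ p')"
| inverse_passage: "(r, r') \<in> P \<Longrightarrow> flip_path P R p p' \<Longrightarrow>
    flip_path P R (reverse_path r @ p) (reverse_path r' @ p')"

text \<open>
  The graph connections on \<open>\<tau>'\<close> defining the same element of \<open>Hom(\<pi>\<^sub>1(F), G)/G\<close> as the graph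
  connection \<open>A\<close> on \<open>\<tau>\<close>.  Homomorphisms are evaluated on cycles based at a vertex which is not
  an end of the flipped edge and hence is common to \<open>\<tau>\<close> and \<open>\<tau>'\<close>.
\<close>

definition flip_image ::
    "('g, 'm) monoid_scheme \<Rightarrow> ('v, 'e) fatgraph \<Rightarrow> ('v, 'e) fatgraph \<Rightarrow>
     'e oedge \<Rightarrow> 'e oedge \<Rightarrow> 'e oedge \<Rightarrow> 'e oedge \<Rightarrow> 'e oedge \<Rightarrow> 'e oedge \<Rightarrow>
     ('e oedge \<Rightarrow> 'g) \<Rightarrow> ('e oedge \<Rightarrow> 'g) set" where
  "flip_image G \<tau> \<tau>' d1 d2 d3 d4 e f A = {A'. graph_connection G \<tau>' A' \<and>
     (\<forall>x \<in> verts \<tau> - {source \<tau> e, target \<tau> e}. \<exists>h\<in>carrier G. \<forall>p p'.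
        is_path \<tau> x p x \<and>
        flip_path (passages d1 d2 d3 d4 e f) (fst ` {d1, d2, d3, d4, e}) p p' \<longrightarrow>
        monodromy G A' p' = h \<otimes>\<^bsub>G\<^esub> monodromy G A p \<otimes>\<^bsub>G\<^esub> inv\<^bsub>G\<^esub> h)}"

end

theory Submission
  imports Defs
begin

text \<open>
  On the flipped edge, factor the group element in the order opposite to that of the coordinates:
  \<open>g(a, b; \<alpha>, \<beta>) = q m p\<close> with \<open>q\<close> lower unipotent with entry \<open>b\<^sup>2 \<beta>\<close>, \<open>p\<close> upper unipotent with entry \<open>b\<^sup>2 \<alpha>\<close>,
  and \<open>m\<close> diagonal (\<open>coord_elem_factor\<close>).  The gauge transformation that moves \<open>p\<close> through the vertex \<open>u\<close>
  and \<open>q\<close> through \<open>v\<close> leaves \<open>m\<close> on edge 5.  It multiplies the elements on edges 3 and 4, which end at \<open>u\<close>, by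
  \<open>p\<close> on the left, and those on edges 1 and 2, which start at \<open>v\<close>, by \<open>q\<close> on the right.  In the coordinates
  these multiplications only shift \<open>\<alpha>\<close> or \<open>\<beta>\<close> and rescale \<open>a\<close> (\<open>coord_elem_upper_mult\<close>,
  \<open>coord_elem_mult_lower\<close>).

  With \<open>m\<close> alone on edge 5, the flip is easy.  Giving \<open>m\<close> to the new edge 5 as well, and a further factor
  \<open>m\<close> to edges 2 and 4, makes the monodromies along all corresponding passages equal
  (\<open>passage_monodromies_if_factored\<close>).  As \<open>m\<close> is diagonal, this multiplies \<open>a\<close> and \<open>b\<close> on edges 2 and 4 and
  rescales one odd coordinate (\<open>coord_elem_mult_diag\<close>), which gives the stated formulas.

  It remains to see that equality on passages characterises the image of the flip
  (\<open>gauge_class_eq_flip_image\<close>).  Carrying paths then preserves monodromies, so one inclusion follows from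
  the behaviour of monodromies under gauge transformations.  For the other inclusion, graph connections
  with conjugate monodromies along all cycles at one vertex are gauge equivalent
  (\<open>gauge_equivalent_if_conjugate_monodromies\<close>), and every cycle of the flipped graph at a vertex outside the
  flip region is homotopic to the image of a cycle of the original graph (\<open>carried_path\<close>).
\<close>

section \<open>Parity and invertibility in Grassmann algebras\<close>

lemma coeff_zero [simp]: "coeff 0 S = 0" by transfer simp
lemma coeff_one: "coeff 1 S = (if S = {} then 1 else 0)" by transfer simp
lemma coeff_add [simp]: "coeff (x + y) S = coeff x S + coeff y S" by transfer simp
lemma coeff_diff [simp]: "coeff (x - y) S = coeff x S - coeff y S" by transfer simp
lemma coeff_uminus [simp]: "coeff (- x) S = - coeff x S" by transfer simp
lemma coeff_scaleR [simp]: "coeff (r *\<^sub>R x) S = r * coeff x S" by transfer simp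
lemma coeff_mult:
  "coeff (x * y) U = (\<Sum>S\<in>Pow U. shuffle_sign S (U - S) * coeff x S * coeff y (U - S))"
  by transfer simp

text \<open>A monomial of a product splits into a monomial of each factor; parities, supports and
  degrees of products are all read off from this splitting.\<close>

lemma coeff_mult_nonzero:
  assumes "coeff (x * y) U \<noteq> 0"
  obtains S T where "U = S \<union> T" "S \<inter> T = {}" "finite U" "coeff x S \<noteq> 0" "coeff y T \<noteq> 0"
proof -
  have fin: "finite U"
    using assms coeff[of "x * y"] by blast
  obtain S where "S \<in> Pow U" "shuffle_sign S (U - S) * coeff x S * coeff y (U - S) \<noteq> 0"
    using assms unfolding coeff_mult by (meson sum.neutral)
  then show ?thesis
    using fin by (intro that[of S "U - S"]) auto
qed

lemma body_mult [simp]: "body (x * y) = body x * body y"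
  by (simp add: body_def coeff_mult)
lemma body_one [simp]: "body 1 = 1" by (simp add: body_def coeff_one)
lemma body_add [simp]: "body (x + y) = body x + body y" by (simp add: body_def)
lemma body_diff [simp]: "body (x - y) = body x - body y" by (simp add: body_def)
lemma body_scaleR [simp]: "body (r *\<^sub>R x) = r * body x" by (simp add: body_def)

lemma grassmann_even_intros [simp, intro]:
  "0 \<in> grassmann_even N" "1 \<in> grassmann_even N"
  "x \<in> grassmann_even N \<Longrightarrow> y \<in> grassmann_even N \<Longrightarrow> x + y \<in> grassmann_even N"
  "x \<in> grassmann_even N \<Longrightarrow> y \<in> grassmann_even N \<Longrightarrow> x - y \<in> grassmann_even N"
  "x \<in> grassmann_even N \<Longrightarrow> - x \<in> grassmann_even N"
  "x \<in> grassmann_even N \<Longrightarrow> r *\<^sub>R x \<in> grassmann_even N"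
  by (simp_all add: grassmann_even_def coeff_one) (metis add_0)+

lemma grassmann_odd_intros [simp, intro]:
  "0 \<in> grassmann_odd N"
  "x \<in> grassmann_odd N \<Longrightarrow> y \<in> grassmann_odd N \<Longrightarrow> x + y \<in> grassmann_odd N"
  "x \<in> grassmann_odd N \<Longrightarrow> y \<in> grassmann_odd N \<Longrightarrow> x - y \<in> grassmann_odd N"
  "x \<in> grassmann_odd N \<Longrightarrow> - x \<in> grassmann_odd N"
  by (simp_all add: grassmann_odd_def) (metis add_0)+

lemma grassmann_parity_mult [simp, intro]:
  "x \<in> grassmann_even N \<Longrightarrow> y \<in> grassmann_even N \<Longrightarrow> x * y \<in> grassmann_even N"
  "x \<in> grassmann_even N \<Longrightarrow> y \<in> grassmann_odd N \<Longrightarrow> x * y \<in> grassmann_odd N"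
  "x \<in> grassmann_odd N \<Longrightarrow> y \<in> grassmann_odd N \<Longrightarrow> x * y \<in> grassmann_even N"
  unfolding grassmann_even_def grassmann_odd_def mem_Collect_eq
  by (intro allI impI; erule coeff_mult_nonzero;
      auto simp: card_Un_disjoint dest!: spec; blast)+

lemma grassmann_even_power [simp, intro]: "x \<in> grassmann_even N \<Longrightarrow> x ^ k \<in> grassmann_even N"
  by (induction k) auto

text \<open>Every pair in \<open>S \<times> T\<close> is an inversion either of \<open>(S, T)\<close> or, after swapping, of \<open>(T, S)\<close>,
  so the two exponents add up to \<open>card S * card T\<close>.\<close>

lemma shuffle_sign_commute:
  assumes "finite S" "finite T" "S \<inter> T = {}"
  shows "shuffle_sign T S = (- 1) ^ (card S * card T) * shuffle_sign S T"
proof -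
  let ?I = "{(i, j). i \<in> S \<and> j \<in> T \<and> j < i}" and ?J = "{(i, j). i \<in> T \<and> j \<in> S \<and> j < i}"
  have "card (S \<times> T) = card (?I \<union> prod.swap ` ?J)"
    using assms(3) by (intro arg_cong[of _ _ card]) (force simp: image_iff)
  also have "\<dots> = card ?I + card (prod.swap ` ?J)"
    using assms by (intro card_Un_disjoint finite_imageI finite_inversions) auto
  also have "card (prod.swap ` ?J) = card ?J"
    by (rule card_image) simp
  finally have "card S * card T = card ?I + card ?J"
    by (simp add: card_cartesian_product)
  then show ?thesis
    by (simp add: shuffle_sign_def power_add)
qed

text \<open>Both sign rules of the algebra at once: by the preceding lemma, exchanging the two factors
  multiplies the contribution of monomials \<open>S\<close> and \<open>T\<close> by \<open>(- 1) ^ (card S * card T)\<close>, and this sign is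
  constant as soon as the parities of the factors are fixed.\<close>

lemma graded_commute:
  assumes "\<And>S T. coeff x S \<noteq> 0 \<Longrightarrow> coeff y T \<noteq> 0 \<Longrightarrow> (- 1) ^ (card S * card T) = (r::real)"
  shows "x * y = r *\<^sub>R (y * x)"
proof -
  have "coeff (x * y) U = coeff (r *\<^sub>R (y * x)) U" for U
  proof (cases "finite U")
    case True
    have "coeff (x * y) U = (\<Sum>T\<in>Pow U. shuffle_sign (U - T) T * coeff x (U - T) * coeff y T)"
      unfolding coeff_mult
      by (rule sum.reindex_bij_witness[of _ "\<lambda>T. U - T" "\<lambda>S. U - S"]) (auto simp: double_diff)
    also have "\<dots> = (\<Sum>T\<in>Pow U. r * (shuffle_sign T (U - T) * coeff y T * coeff x (U - T)))"
    proof (rule sum.cong[OF refl])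
      fix T assume T: "T \<in> Pow U"
      have "shuffle_sign (U - T) T = (- 1) ^ (card (U - T) * card T) * shuffle_sign T (U - T)"
        using shuffle_sign_commute[of T "U - T"] True T
        by (auto simp: mult.commute intro: finite_subset)
      then show "shuffle_sign (U - T) T * coeff x (U - T) * coeff y T =
          r * (shuffle_sign T (U - T) * coeff y T * coeff x (U - T))"
        using assms[of "U - T" T] by (cases "coeff x (U - T) = 0"; cases "coeff y T = 0") auto
    qed
    also have "\<dots> = coeff (r *\<^sub>R (y * x)) U"
      by (simp add: coeff_mult sum_distrib_left)
    finally show ?thesis .
  next
    case False
    then show ?thesis by (metis (mono_tags, lifting) coeff mem_Collect_eq)
  qed
  then show ?thesis
    using coeff_inject by blast
qed

lemma even_central:
  assumes "x \<in> grassmann_even N"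
  shows "x * y = y * x"
  using graded_commute[of x y 1] assms
  by (simp add: grassmann_even_def)

lemma odd_anticommute:
  assumes "x \<in> grassmann_odd N" "y \<in> grassmann_odd N"
  shows "x * y = - (y * x)"
  using graded_commute[of x y "-1"] assms
  by (simp add: grassmann_odd_def)

lemma odd_square:
  assumes "x \<in> grassmann_odd N"
  shows "x * x = 0" "x * (x * y) = 0"
proof -
  have "2 *\<^sub>R (x * x) = 0"
    using odd_anticommute[OF assms assms] by (metis scaleR_2 left_minus)
  then show "x * x = 0" by simp
  then show "x * (x * y) = 0" by (simp flip: mult.assoc)
qed

text \<open>An element without body has all its monomials of degree at least 1, so those of its \<open>k\<close>-th power
  have degree at least \<open>k\<close>; but on \<open>N\<close> generators the degree is at most \<open>N\<close>.\<close>

lemma nilpotent_if_body_zero: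
  assumes "x \<in> grassmann_even N" "body x = 0"
  shows "x ^ Suc N = 0"
proof -
  have *: "coeff (x ^ k) S \<noteq> 0 \<Longrightarrow> k \<le> card S" for k S
  proof (induction k arbitrary: S)
    case (Suc k)
    from Suc.prems have "coeff (x * x ^ k) S \<noteq> 0" by simp
    then obtain A B where AB: "S = A \<union> B" "A \<inter> B = {}" "finite S"
        "coeff x A \<noteq> 0" "coeff (x ^ k) B \<noteq> 0"
      by (rule coeff_mult_nonzero)
    have "A \<noteq> {}" using AB(4) assms(2) by (auto simp: body_def)
    then have "card A \<noteq> 0" using AB by auto
    then show ?case using Suc.IH[OF AB(5)] AB by (simp add: card_Un_disjoint)
  qed simp
  have "coeff (x ^ Suc N) S = coeff 0 S" for S
  proof (rule ccontr)
    assume "coeff (x ^ Suc N) S \<noteq> coeff 0 S"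
    then have nz: "coeff (x ^ Suc N) S \<noteq> 0" by simp
    moreover have "x ^ Suc N \<in> grassmann_even N" using assms by blast
    ultimately have "S \<subseteq> {..<N}" unfolding grassmann_even_def by blast
    then have "card S \<le> N" using card_mono[of "{..<N}" S] by simp
    with *[OF nz] show False by simp
  qed
  then show ?thesis
    using coeff_inject by blast
qed

text \<open>After scaling the body to 1, the element is \<open>1 - n\<close> with \<open>n\<close> nilpotent, and the geometric series
  of \<open>n\<close> is finite.\<close>

lemma pos_inverse:
  assumes "x \<in> grassmann_pos N"
  shows "inverse x \<in> grassmann_pos N" "x * inverse x = 1" "inverse x * x = 1"
proof -
  let ?r = "body x"
  have x: "x \<in> grassmann_even N" "0 < ?r"
    using assms by (auto simp: grassmann_pos_def)
  \<comment> \<open>the nilpotent part, so that \<open>x = body x (1 - n)\<close>\<close>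
  define n where "n = 1 - (1 / ?r) *\<^sub>R x"
  define y where "y = (1 / ?r) *\<^sub>R (\<Sum>i\<le>N. n ^ i)"
  have n: "n \<in> grassmann_even N" "body n = 0"
    using x by (auto simp: n_def)
  have geometric: "(1 - n) * (\<Sum>i\<le>k. n ^ i) = 1 - n ^ Suc k" for k
  proof (induction k)
    case (Suc k)
    have "(1 - n) * (\<Sum>i\<le>Suc k. n ^ i) = (1 - n ^ Suc k) + (1 - n) * n ^ Suc k"
      by (simp only: sum.atMost_Suc distrib_left Suc.IH)
    then show ?case by (simp add: left_diff_distrib)
  qed simp
  have "(1 - n) * (\<Sum>i\<le>N. n ^ i) = 1"
    by (simp only: geometric nilpotent_if_body_zero[OF n] diff_zero)
  moreover have "1 - n = (1 / ?r) *\<^sub>R x"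
    by (simp add: n_def)
  ultimately have xy: "x * y = 1"
    by (simp add: y_def)
  then have yx: "y * x = 1"
    using even_central[OF x(1)] by simp
  have sum: "(\<Sum>i\<le>k. n ^ i) \<in> grassmann_even N" for k
    by (induction k) (use n in auto)
  have "?r * body y = 1"
    using arg_cong[OF xy, of body] by simp
  then have "0 < body y"
    using x(2) by (metis zero_less_mult_pos zero_less_one)
  then have y: "y \<in> grassmann_pos N"
    using sum by (auto simp: y_def grassmann_pos_def)
  have "inverse x = y"
    unfolding inverse_grassmann_def
  proof (rule the_equality)
    fix z assume "x * z = 1 \<and> z * x = 1"
    then show "z = y" using xy by (metis mult.assoc mult.left_neutral mult.right_neutral)
  qed (use xy yx in simp)
  with xy yx y show "inverse x \<in> grassmann_pos N" "x * inverse x = 1" "inverse x * x = 1"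
    by simp_all
qed

lemma body_odd: "x \<in> grassmann_odd N \<Longrightarrow> body x = 0"
  by (fastforce simp: grassmann_odd_def body_def)

lemma grassmann_posD: "x \<in> grassmann_pos N \<Longrightarrow> x \<in> grassmann_even N"
  by (simp add: grassmann_pos_def)

lemma grassmann_pos_mult: "x \<in> grassmann_pos N \<Longrightarrow> y \<in> grassmann_pos N \<Longrightarrow> x * y \<in> grassmann_pos N"
  by (auto simp: grassmann_pos_def)

section \<open>Supermatrices and their coordinates\<close>

text \<open>As ordered rewrite rules, these sort the even factors of a product.  Instances of \<open>odd_ac\<close> put
  chosen pairs of odd factors into a chosen order, and \<open>odd_square\<close> then deletes products with a
  repeated odd factor.  Expanding and sorting in this way verifies the supermatrix identities below.\<close>

lemma even_ac:
  assumes "x \<in> grassmann_even N"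
  shows "x * y = y * x" "x * (y * z) = y * (x * z)" "y * (x * z) = x * (y * z)"
proof -
  show "x * y = y * x"
    by (rule even_central[OF assms])
  then show "x * (y * z) = y * (x * z)" "y * (x * z) = x * (y * z)"
    by (simp_all only: flip: mult.assoc)
qed

lemma odd_ac:
  assumes "x \<in> grassmann_odd N" "y \<in> grassmann_odd N"
  shows "x * y = - (y * x)" "x * (y * z) = - (y * (x * z))"
proof -
  show "x * y = - (y * x)"
    by (rule odd_anticommute[OF assms])
  then show "x * (y * z) = - (y * (x * z))"
    by (simp only: flip: mult.assoc mult_minus_left)
qed

text \<open>The off-diagonal entries contain products of three odd elements, such as \<open>\<alpha> \<delta> \<epsilon>\<close> on one side and
  \<open>\<delta> \<epsilon> \<alpha>\<close> on the other; they agree because the product of two odd elements is even.\<close>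

lemma smat_mult_assoc:
  assumes "a \<in> grassmann_even N" "b \<in> grassmann_even N" "c \<in> grassmann_even N"
    "d \<in> grassmann_even N" "e \<in> grassmann_even N" "f \<in> grassmann_even N"
    and "\<alpha> \<in> grassmann_odd N" "\<beta> \<in> grassmann_odd N" "\<gamma> \<in> grassmann_odd N"
    "\<delta> \<in> grassmann_odd N" "\<epsilon> \<in> grassmann_odd N" "\<zeta> \<in> grassmann_odd N"
  shows "smat_mult (smat_mult (SMat a \<alpha> \<beta> b) (SMat c \<gamma> \<delta> d)) (SMat e \<epsilon> \<zeta> f) =
    smat_mult (SMat a \<alpha> \<beta> b) (smat_mult (SMat c \<gamma> \<delta> d) (SMat e \<epsilon> \<zeta> f))"
proof -
  have "\<alpha> * (\<delta> * \<epsilon>) = \<delta> * (\<epsilon> * \<alpha>)" "\<beta> * (\<gamma> * \<zeta>) = \<gamma> * (\<zeta> * \<beta>)"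
    using even_central[of "\<delta> * \<epsilon>" N \<alpha>] even_central[of "\<gamma> * \<zeta>" N \<beta>] assms(7-12)
    by (simp_all add: mult.assoc)
  then show ?thesis
    by (simp add: algebra_simps even_ac[of _ N] assms(1-6))
qed

lemma GL11_simps [simp]:
  "monoid.mult (GL11 N) = smat_mult" "one (GL11 N) = SMat 1 0 0 1"
  "SMat a \<alpha> \<beta> b \<in> carrier (GL11 N) \<longleftrightarrow> a \<in> grassmann_pos N \<and> b \<in> grassmann_pos N \<and>
     \<alpha> \<in> grassmann_odd N \<and> \<beta> \<in> grassmann_odd N"
  by (simp_all add: GL11_def)

lemma GL11_cases:
  assumes "x \<in> carrier (GL11 N)"
  obtains a \<alpha> \<beta> b where "x = SMat a \<alpha> \<beta> b" "a \<in> grassmann_pos N" "b \<in> grassmann_pos N"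
    "\<alpha> \<in> grassmann_odd N" "\<beta> \<in> grassmann_odd N"
  using assms by (auto simp: GL11_def)

lemma grassmann_pos_one: "1 \<in> grassmann_pos N"
  by (simp add: grassmann_pos_def)

text \<open>Multiplying by the matrix with rows \<open>(a\<inverse>, - a\<inverse> b\<inverse> \<alpha>)\<close> and \<open>(- a\<inverse> b\<inverse> \<beta>, b\<inverse>)\<close> gives the diagonal matrix
  with entries \<open>1 + t\<close> and \<open>1 - t\<close>, where \<open>t = a\<inverse> b\<inverse> \<alpha> \<beta>\<close>.  As \<open>t\<^sup>2 = 0\<close>, the factors \<open>1 - t\<close> and \<open>1 + t\<close>
  correct this, and they do not affect the odd entries because \<open>t \<alpha> = t \<beta> = 0\<close>.\<close>

lemma smat_left_inverse:
  assumes "a \<in> grassmann_pos N" "b \<in> grassmann_pos N"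
    "\<alpha> \<in> grassmann_odd N" "\<beta> \<in> grassmann_odd N"
  defines "a' \<equiv> inverse a" and "b' \<equiv> inverse b"
  shows "smat_mult (SMat (a' * (1 - a' * b' * \<alpha> * \<beta>)) (- (a' * b' * \<alpha>)) (- (a' * b' * \<beta>))
    (b' * (1 + a' * b' * \<alpha> * \<beta>))) (SMat a \<alpha> \<beta> b) = SMat 1 0 0 1"
proof -
  have inv: "a' * a = 1" "b' * b = 1" "a * a' = 1" "b * b' = 1"
    using pos_inverse assms by auto
  then have inv_left: "a' * (a * z) = z" "b' * (b * z) = z" "a * (a' * z) = z" "b * (b' * z) = z" for z
    by (simp_all flip: mult.assoc)
  have ev: "a \<in> grassmann_even N" "b \<in> grassmann_even N" "a' \<in> grassmann_even N" "b' \<in> grassmann_even N"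
    using assms pos_inverse by (auto simp: grassmann_pos_def)
  show ?thesis
    by (simp add: algebra_simps even_ac[of _ N] ev inv inv_left
      odd_square[OF assms(3)] odd_square[OF assms(4)] odd_ac[OF assms(4,3)])
qed

lemma group_GL11: "group (GL11 N)"
proof (rule groupI)
  fix x y assume "x \<in> carrier (GL11 N)" "y \<in> carrier (GL11 N)"
  then show "x \<otimes>\<^bsub>GL11 N\<^esub> y \<in> carrier (GL11 N)"
    by (elim GL11_cases) (auto simp: grassmann_pos_def body_odd)
next
  fix x y z assume "x \<in> carrier (GL11 N)" "y \<in> carrier (GL11 N)" "z \<in> carrier (GL11 N)"
  then show "x \<otimes>\<^bsub>GL11 N\<^esub> y \<otimes>\<^bsub>GL11 N\<^esub> z = x \<otimes>\<^bsub>GL11 N\<^esub> (y \<otimes>\<^bsub>GL11 N\<^esub> z)"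
    unfolding GL11_simps
    by (elim GL11_cases) (simp only:, rule smat_mult_assoc[where N = N]; simp add: grassmann_posD)
next
  fix x assume "x \<in> carrier (GL11 N)"
  then obtain a \<alpha> \<beta> b where x: "x = SMat a \<alpha> \<beta> b" "a \<in> grassmann_pos N" "b \<in> grassmann_pos N"
    "\<alpha> \<in> grassmann_odd N" "\<beta> \<in> grassmann_odd N"
    by (rule GL11_cases)
  then show "\<one>\<^bsub>GL11 N\<^esub> \<otimes>\<^bsub>GL11 N\<^esub> x = x"
    by simp
  let ?a = "inverse a" and ?b = "inverse b"
  have "SMat (?a * (1 - ?a * ?b * \<alpha> * \<beta>)) (- (?a * ?b * \<alpha>)) (- (?a * ?b * \<beta>))
      (?b * (1 + ?a * ?b * \<alpha> * \<beta>)) \<in> carrier (GL11 N)"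
    using pos_inverse(1)[OF x(2)] pos_inverse(1)[OF x(3)] x(4,5)
    by (auto simp: grassmann_pos_def body_odd)
  with smat_left_inverse[OF x(2-5)] show "\<exists>y\<in>carrier (GL11 N). y \<otimes>\<^bsub>GL11 N\<^esub> x = \<one>\<^bsub>GL11 N\<^esub>"
    unfolding x(1) GL11_simps(1,2) by (rule bexI)
qed (simp add: grassmann_pos_one)

text \<open>The triangular product alone has diagonal \<open>(b\<inverse> - b \<alpha> \<beta>, b)\<close>.  The scalar \<open>1 + b\<^sup>2 \<alpha> \<beta> / 2\<close> spreads the
  relative correction \<open>- b\<^sup>2 \<alpha> \<beta>\<close> of the first entry evenly, with opposite signs, over both.\<close>

lemma coord_elem_entries:
  assumes "b \<in> grassmann_pos N" "a \<in> grassmann_pos N" "\<alpha> \<in> grassmann_odd N" "\<beta> \<in> grassmann_odd N"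
  shows "coord_elem (a, b, \<alpha>, \<beta>) =
    SMat (a * (inverse b - (1/2) *\<^sub>R (b * (\<alpha> * \<beta>)))) (a * (b * \<alpha>)) (a * (b * \<beta>))
      (a * (b + (1/2) *\<^sub>R (b * (b * (b * (\<alpha> * \<beta>))))))"
proof -
  define c where "c = inverse b"
  have inv: "b * c = 1" "c * b = 1" using pos_inverse[OF assms(1)] by (simp_all add: c_def)
  then have inv_left: "b * (c * z) = z" "c * (b * z) = z" for z by (simp_all flip: mult.assoc)
  have ev: "a \<in> grassmann_even N" "b \<in> grassmann_even N" "c \<in> grassmann_even N"
    using assms pos_inverse by (auto simp: grassmann_pos_def c_def)
  show ?thesis
    unfolding coord_elem.simps c_def[symmetric]
    by (simp add: algebra_simps even_ac[of _ N] ev inv inv_left power2_eq_square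
      odd_square[OF assms(3)] odd_square[OF assms(4)] odd_ac[OF assms(4,3)])
      (simp flip: scaleR_add_left)
qed

lemma inverse_mult_pos:
  assumes "a \<in> grassmann_pos N" "b \<in> grassmann_pos N"
  shows "inverse (a * b) = inverse a * inverse b"
proof -
  have "inverse b * inverse a * (a * b) = 1"
    by (metis assms pos_inverse(3) mult.assoc mult.left_neutral)
  then have "inverse b * inverse a = inverse (a * b)"
    by (metis assms pos_inverse(2) grassmann_pos_mult mult.assoc mult.left_neutral mult.right_neutral)
  then show ?thesis
    using even_central pos_inverse(1) assms grassmann_posD by metis
qed

text \<open>A lower unipotent factor on the right is absorbed by the last factor of the decomposition, so only
  \<open>\<beta>\<close> moves.  The coordinate \<open>a\<close> compensates the change of the scalar \<open>1 + b\<^sup>2 \<alpha> \<beta> / 2\<close>; the terms with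
  two factors \<open>\<alpha>\<close> vanish.\<close>

lemma coord_elem_mult_lower:
  assumes "b \<in> grassmann_pos N" "a \<in> grassmann_pos N"
    "\<alpha> \<in> grassmann_odd N" "\<beta> \<in> grassmann_odd N" "\<gamma> \<in> grassmann_odd N"
  shows "smat_mult (coord_elem (a, b, \<alpha>, \<beta>)) (SMat 1 0 \<gamma> 1) =
    coord_elem (a * (1 - (1/2) *\<^sub>R (b\<^sup>2 * (\<alpha> * \<gamma>))), b, \<alpha>, \<beta> + \<gamma>)"
proof -
  define c where "c = inverse b"
  have inv: "b * c = 1" "c * b = 1" using pos_inverse[OF assms(1)] by (simp_all add: c_def)
  then have inv_left: "b * (c * z) = z" "c * (b * z) = z" for z by (simp_all flip: mult.assoc)
  have ev: "a \<in> grassmann_even N" "b \<in> grassmann_even N" "c \<in> grassmann_even N"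
    using assms pos_inverse by (auto simp: grassmann_pos_def c_def)
  have pos: "a * (1 - (1/2) *\<^sub>R (b\<^sup>2 * (\<alpha> * \<gamma>))) \<in> grassmann_pos N"
    using assms by (auto simp: grassmann_pos_def body_odd)
  have odd: "\<beta> + \<gamma> \<in> grassmann_odd N" using assms by simp
  show ?thesis
    unfolding coord_elem_entries[OF assms(1,2,3,4)] coord_elem_entries[OF assms(1) pos assms(3) odd] c_def[symmetric]
    by (simp add: algebra_simps even_ac[of _ N] ev inv inv_left power2_eq_square
      odd_square[OF assms(3)] odd_square[OF assms(4)] odd_ac[OF assms(4,3)]
      odd_square[OF assms(5)] odd_ac[OF assms(5,3)] odd_ac[OF assms(5,4)])
      (simp flip: scaleR_add_left)
qed

text \<open>The mirror image of the preceding lemma: an upper unipotent factor on the left is absorbed by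
  the first factor of the decomposition.\<close>

lemma coord_elem_upper_mult:
  assumes "b \<in> grassmann_pos N" "a \<in> grassmann_pos N"
    "\<alpha> \<in> grassmann_odd N" "\<beta> \<in> grassmann_odd N" "\<gamma> \<in> grassmann_odd N"
  shows "smat_mult (SMat 1 \<gamma> 0 1) (coord_elem (a, b, \<alpha>, \<beta>)) =
    coord_elem (a * (1 - (1/2) *\<^sub>R (b\<^sup>2 * (\<gamma> * \<beta>))), b, \<alpha> + \<gamma>, \<beta>)"
proof -
  define c where "c = inverse b"
  have inv: "b * c = 1" "c * b = 1" using pos_inverse[OF assms(1)] by (simp_all add: c_def)
  then have inv_left: "b * (c * z) = z" "c * (b * z) = z" for z by (simp_all flip: mult.assoc)
  have ev: "a \<in> grassmann_even N" "b \<in> grassmann_even N" "c \<in> grassmann_even N"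
    using assms pos_inverse by (auto simp: grassmann_pos_def c_def)
  have pos: "a * (1 - (1/2) *\<^sub>R (b\<^sup>2 * (\<gamma> * \<beta>))) \<in> grassmann_pos N"
    using assms by (auto simp: grassmann_pos_def body_odd)
  have odd: "\<alpha> + \<gamma> \<in> grassmann_odd N" using assms by simp
  show ?thesis
    unfolding coord_elem_entries[OF assms(1,2,3,4)] coord_elem_entries[OF assms(1) pos odd assms(4)] c_def[symmetric]
    by (simp add: algebra_simps even_ac[of _ N] ev inv inv_left power2_eq_square
      odd_square[OF assms(3)] odd_square[OF assms(4)] odd_ac[OF assms(4,3)]
      odd_square[OF assms(5)] odd_ac[OF assms(5,3)] odd_ac[OF assms(5,4)])
      (simp flip: scaleR_add_left)
qed

text \<open>Tuples with vanishing odd part represent diagonal matrices.  Moving one past a unipotent factor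
  rescales the odd coordinate by \<open>1 / d\<^sup>2\<close>, and \<open>(b d)\<^sup>2 \<alpha> (\<beta> / d\<^sup>2) = b\<^sup>2 \<alpha> \<beta>\<close>, so the scalar
  \<open>1 + b\<^sup>2 \<alpha> \<beta> / 2\<close> is unchanged.\<close>

lemma coord_elem_mult_diag:
  assumes "b \<in> grassmann_pos N" "a \<in> grassmann_pos N" "d \<in> grassmann_pos N" "x \<in> grassmann_pos N"
    "\<alpha> \<in> grassmann_odd N" "\<beta> \<in> grassmann_odd N"
  shows "smat_mult (coord_elem (a, b, \<alpha>, \<beta>)) (coord_elem (x, d, 0, 0)) =
      coord_elem (a * x, b * d, \<alpha>, (inverse d)\<^sup>2 * \<beta>)"
    "smat_mult (coord_elem (x, d, 0, 0)) (coord_elem (a, b, \<alpha>, \<beta>)) =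
      coord_elem (a * x, b * d, (inverse d)\<^sup>2 * \<alpha>, \<beta>)"
proof -
  define c where "c = inverse b"
  define e where "e = inverse d"
  have inv: "b * c = 1" "c * b = 1" "d * e = 1" "e * d = 1"
    using pos_inverse[OF assms(1)] pos_inverse[OF assms(3)] by (simp_all add: c_def e_def)
  then have inv_left: "b * (c * z) = z" "c * (b * z) = z" "d * (e * z) = z" "e * (d * z) = z" for z
    by (simp_all flip: mult.assoc)
  have ev: "a \<in> grassmann_even N" "b \<in> grassmann_even N" "c \<in> grassmann_even N"
     "d \<in> grassmann_even N" "x \<in> grassmann_even N" "e \<in> grassmann_even N"
    using assms pos_inverse by (auto simp: grassmann_pos_def c_def e_def)
  have pos: "a * x \<in> grassmann_pos N" "b * d \<in> grassmann_pos N"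
    using assms by (auto simp: grassmann_pos_def)
  have odd: "e\<^sup>2 * \<alpha> \<in> grassmann_odd N" "e\<^sup>2 * \<beta> \<in> grassmann_odd N" using assms ev by auto
  show "smat_mult (coord_elem (a, b, \<alpha>, \<beta>)) (coord_elem (x, d, 0, 0)) =
      coord_elem (a * x, b * d, \<alpha>, (inverse d)\<^sup>2 * \<beta>)"
    unfolding e_def[symmetric]
      coord_elem_entries[OF assms(1,2,5,6)]
      coord_elem_entries[OF assms(3,4) grassmann_odd_intros(1) grassmann_odd_intros(1)]
      coord_elem_entries[OF pos(2,1) assms(5) odd(2)] inverse_mult_pos[OF assms(1,3)]
      c_def[symmetric] e_def[symmetric]
    by (simp add: algebra_simps even_ac[of _ N] ev inv inv_left power2_eq_square)
  show "smat_mult (coord_elem (x, d, 0, 0)) (coord_elem (a, b, \<alpha>, \<beta>)) =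
      coord_elem (a * x, b * d, (inverse d)\<^sup>2 * \<alpha>, \<beta>)"
    unfolding e_def[symmetric]
      coord_elem_entries[OF assms(1,2,5,6)]
      coord_elem_entries[OF assms(3,4) grassmann_odd_intros(1) grassmann_odd_intros(1)]
      coord_elem_entries[OF pos(2,1) odd(1) assms(6)] inverse_mult_pos[OF assms(1,3)]
      c_def[symmetric] e_def[symmetric]
    by (simp add: algebra_simps even_ac[of _ N] ev inv inv_left power2_eq_square)
qed

text \<open>The decomposition in the opposite order, lower times diagonal times upper.  Upper and lower
  unipotent matrices with entries \<open>\<alpha>\<close> and \<open>\<beta>\<close> commute up to the central scalar \<open>1 - \<alpha> \<beta>\<close>; with
  \<open>b\<^sup>2 \<beta>\<close> in place of \<open>\<beta>\<close>, this scalar turns \<open>1 + b\<^sup>2 \<alpha> \<beta> / 2\<close> into \<open>1 - b\<^sup>2 \<alpha> \<beta> / 2\<close>.\<close>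

lemma coord_elem_factor:
  assumes "b \<in> grassmann_pos N" "a \<in> grassmann_pos N" "\<alpha> \<in> grassmann_odd N" "\<beta> \<in> grassmann_odd N"
  shows "coord_elem (a, b, \<alpha>, \<beta>) =
    smat_mult (smat_mult (SMat 1 0 (b\<^sup>2 * \<beta>) 1)
       (coord_elem (a * (1 - (1/2) *\<^sub>R (b\<^sup>2 * (\<alpha> * \<beta>))), b, 0, 0))) (SMat 1 (b\<^sup>2 * \<alpha>) 0 1)"
proof -
  define c where "c = inverse b"
  have inv: "b * c = 1" "c * b = 1" using pos_inverse[OF assms(1)] by (simp_all add: c_def)
  then have inv_left: "b * (c * z) = z" "c * (b * z) = z" for z by (simp_all flip: mult.assoc)
  have ev: "a \<in> grassmann_even N" "b \<in> grassmann_even N" "c \<in> grassmann_even N"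
    using assms pos_inverse by (auto simp: grassmann_pos_def c_def)
  have pos: "a * (1 - (1/2) *\<^sub>R (b\<^sup>2 * (\<alpha> * \<beta>))) \<in> grassmann_pos N"
    using assms by (auto simp: grassmann_pos_def body_odd)
  show ?thesis
    unfolding coord_elem_entries[OF assms(1,2,3,4)]
      coord_elem_entries[OF assms(1) pos grassmann_odd_intros(1) grassmann_odd_intros(1)] c_def[symmetric]
    by (simp add: algebra_simps even_ac[of _ N] ev inv inv_left power2_eq_square
      odd_square[OF assms(3)] odd_square[OF assms(4)] odd_ac[OF assms(4,3)])
      (simp flip: scaleR_add_left)
qed

section \<open>Paths, monodromies and gauge equivalence\<close>

lemma rev_edge_simps [simp]:
  "rev_edge (rev_edge d) = d" "fst (rev_edge d) = fst d" "rev_edge d \<in> oedges \<tau> \<longleftrightarrow> d \<in> oedges \<tau>"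
  "rev_edge d \<noteq> d" "d \<noteq> rev_edge d" "rev_edge d = rev_edge d' \<longleftrightarrow> d = d'"
  by (auto simp: rev_edge_def oedges_def prod_eq_iff mem_Times_iff)

lemma source_rev_edge [simp]: "source \<tau> (rev_edge d) = target \<tau> d"
  and target_rev_edge [simp]: "target \<tau> (rev_edge d) = source \<tau> d"
  by (simp_all add: target_def)

lemma target_in_verts:
  assumes "source \<tau> ` oedges \<tau> \<subseteq> verts \<tau>" "d \<in> oedges \<tau>"
  shows "target \<tau> d \<in> verts \<tau>"
  using assms(1) rev_edge_simps(3)[of d \<tau>] assms(2) by (metis image_subset_iff source_rev_edge)

lemma reverse_path_simps [simp]:
  "reverse_path [] = []" "reverse_path (d # p) = reverse_path p @ [rev_edge d]"
  "reverse_path (p @ q) = reverse_path q @ reverse_path p" "reverse_path (reverse_path p) = p"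
  by (simp_all add: reverse_path_def rev_map comp_def)

lemma is_path_oedges: "is_path \<tau> x p y \<Longrightarrow> set p \<subseteq> oedges \<tau>"
  by (induction p arbitrary: x) auto

lemma is_path_verts:
  assumes "source \<tau> ` oedges \<tau> \<subseteq> verts \<tau>" "is_path \<tau> x p y"
  shows "x \<in> verts \<tau>" "y \<in> verts \<tau>"
proof -
  show "y \<in> verts \<tau>" using assms(2) by (induction p arbitrary: x) auto
  show "x \<in> verts \<tau>" using assms by (cases p) auto
qed

lemma is_path_append:
  assumes "source \<tau> ` oedges \<tau> \<subseteq> verts \<tau>"
  shows "is_path \<tau> x (p @ q) z \<longleftrightarrow> (\<exists>y. is_path \<tau> x p y \<and> is_path \<tau> y q z)"
  by (induction p arbitrary: x) (use is_path_verts[OF assms] in auto)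

lemma is_path_reverse:
  assumes "source \<tau> ` oedges \<tau> \<subseteq> verts \<tau>" "is_path \<tau> x p y"
  shows "is_path \<tau> y (reverse_path p) x"
  using assms(2)
proof (induction p arbitrary: x)
  case (Cons d p)
  then have "x \<in> verts \<tau>" using assms(1) by auto
  with Cons show ?case by (auto simp: is_path_append[OF assms(1)])
qed simp

context group
begin

lemma cancel_inv_left:
  assumes "x \<in> carrier G" "y \<in> carrier G"
  shows "inv x \<otimes> (x \<otimes> y) = y" "x \<otimes> (inv x \<otimes> y) = y"
  using assms by (simp_all flip: m_assoc)

lemma graph_connection_closed:
  "graph_connection G \<tau> A \<Longrightarrow> d \<in> oedges \<tau> \<Longrightarrow> A d \<in> carrier G"
  "graph_connection G \<tau> A \<Longrightarrow> d \<in> oedges \<tau> \<Longrightarrow> A (rev_edge d) = inv (A d)"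
  by (auto simp: graph_connection_def)

lemma monodromy_closed [simp]:
  "graph_connection G \<tau> A \<Longrightarrow> set p \<subseteq> oedges \<tau> \<Longrightarrow> monodromy G A p \<in> carrier G"
  by (induction p) (auto simp: graph_connection_closed)

lemma monodromy_append:
  assumes "graph_connection G \<tau> A" "set p \<subseteq> oedges \<tau>" "set q \<subseteq> oedges \<tau>"
  shows "monodromy G A (p @ q) = monodromy G A q \<otimes> monodromy G A p"
  using assms by (induction p) (auto simp: m_assoc graph_connection_closed)

lemma monodromy_reverse:
  assumes "graph_connection G \<tau> A" "set p \<subseteq> oedges \<tau>"
  shows "monodromy G A (reverse_path p) = inv (monodromy G A p)"
  using assms(2)
proof (induction p)
  case (Cons d p)
  moreover have "set (reverse_path p) \<subseteq> oedges \<tau>"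
    using Cons.prems by (auto simp: reverse_path_def)
  ultimately show ?case
    using assms(1) by (simp add: monodromy_append graph_connection_closed inv_mult_group)
qed simp

lemma monodromy_gauge:
  assumes A: "graph_connection G \<tau> A" and h: "h \<in> verts \<tau> \<rightarrow> carrier G"
    and B: "\<And>d. d \<in> oedges \<tau> \<Longrightarrow> B d = inv (h (target \<tau> d)) \<otimes> A d \<otimes> h (source \<tau> d)"
    and V: "source \<tau> ` oedges \<tau> \<subseteq> verts \<tau>" and p: "is_path \<tau> x p y"
  shows "monodromy G B p = inv (h y) \<otimes> monodromy G A p \<otimes> h x"
  using p
proof (induction p arbitrary: x)
  case Nil
  then have "h y \<in> carrier G" using h by auto
  then show ?case using Nil by simp
next
  case (Cons d p)
  let ?z = "target \<tau> d"
  have path: "is_path \<tau> ?z p y" and d: "d \<in> oedges \<tau>" "source \<tau> d = x"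
    using Cons.prems by auto
  have "x \<in> verts \<tau>" "y \<in> verts \<tau>" "?z \<in> verts \<tau>"
    using is_path_verts[OF V Cons.prems] is_path_verts[OF V path] by auto
  then have [simp]: "h x \<in> carrier G" "h y \<in> carrier G" "h ?z \<in> carrier G"
    using h by auto
  have [simp]: "A d \<in> carrier G" "monodromy G A p \<in> carrier G"
    using A d is_path_oedges[OF path] by (auto simp: graph_connection_closed)
  show ?case
    using d by (simp add: Cons.IH[OF path] B m_assoc cancel_inv_left)
qed

text \<open>A gauge transformation from \<open>A\<close> to \<open>B\<close> is determined along paths by its value \<open>inv h\<close> at \<open>x\<close>: choosing a
  path \<open>q y\<close> from \<open>x\<close> to each vertex \<open>y\<close> prescribes \<open>k y\<close>.  That \<open>k\<close> also transforms an edge \<open>d\<close> from \<open>y\<close> to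
  \<open>z\<close> correctly is the hypothesis for the cycle \<open>q y\<close>, \<open>d\<close>, \<open>q z\<close> reversed.\<close>

lemma gauge_equivalent_if_conjugate_monodromies:
  assumes A: "graph_connection G \<tau> A" and B: "graph_connection G \<tau> B"
    and V: "source \<tau> ` oedges \<tau> \<subseteq> verts \<tau>"
    and connected: "\<And>y. y \<in> verts \<tau> \<Longrightarrow> \<exists>p. is_path \<tau> x p y"
    and h: "h \<in> carrier G"
    and conj: "\<And>p. is_path \<tau> x p x \<Longrightarrow> monodromy G B p = h \<otimes> monodromy G A p \<otimes> inv h"
  shows "gauge_equivalent G \<tau> A B"
proof -
  obtain q where q: "\<And>y. y \<in> verts \<tau> \<Longrightarrow> is_path \<tau> x (q y) y"
    using connected by metis
  let ?a = "\<lambda>y. monodromy G A (q y)" and ?b = "\<lambda>y. monodromy G B (q y)"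
  have closed: "?a y \<in> carrier G" "?b y \<in> carrier G" if "y \<in> verts \<tau>" for y
    using A B is_path_oedges[OF q[OF that]] by auto
  define k where "k y = ?a y \<otimes> inv h \<otimes> inv (?b y)" for y
  have "B d = inv (k (target \<tau> d)) \<otimes> A d \<otimes> k (source \<tau> d)" if d: "d \<in> oedges \<tau>" for d
  proof -
    let ?y = "source \<tau> d" and ?z = "target \<tau> d"
    have yz: "?y \<in> verts \<tau>" "?z \<in> verts \<tau>"
      using V d target_in_verts[OF V d] by auto
    let ?l = "q ?y @ d # reverse_path (q ?z)"
    have "is_path \<tau> x ?l x"
      using q[OF yz(1)] is_path_reverse[OF V q[OF yz(2)]] d by (auto simp: is_path_append[OF V])
    then have eq: "monodromy G B ?l = h \<otimes> monodromy G A ?l \<otimes> inv h"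
      by (rule conj)
    have sets: "set (q ?y) \<subseteq> oedges \<tau>" "set (q ?z) \<subseteq> oedges \<tau>" "set (reverse_path (q ?z)) \<subseteq> oedges \<tau>"
      using is_path_oedges[OF q[OF yz(1)]] is_path_oedges[OF q[OF yz(2)]]
      by (auto simp: reverse_path_def)
    have [simp]: "A d \<in> carrier G" "B d \<in> carrier G" "?a ?y \<in> carrier G" "?a ?z \<in> carrier G"
      "?b ?y \<in> carrier G" "?b ?z \<in> carrier G" "h \<in> carrier G"
      using closed yz A B d h by (auto simp: graph_connection_closed)
    have "monodromy G C ?l = inv (monodromy G C (q ?z)) \<otimes> C d \<otimes> monodromy G C (q ?y)"
      if "graph_connection G \<tau> C" for C
      using that sets d monodromy_append[OF that, of "q ?y" "d # reverse_path (q ?z)"]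
      by (simp add: monodromy_reverse)
    from eq[unfolded this[OF A] this[OF B]]
    have e: "inv (?b ?z) \<otimes> B d \<otimes> ?b ?y = h \<otimes> (inv (?a ?z) \<otimes> A d \<otimes> ?a ?y) \<otimes> inv h" .
    have "B d = ?b ?z \<otimes> (inv (?b ?z) \<otimes> B d \<otimes> ?b ?y) \<otimes> inv (?b ?y)"
      by (simp add: m_assoc cancel_inv_left)
    also have "\<dots> = inv (k ?z) \<otimes> A d \<otimes> k ?y"
      unfolding e k_def by (simp add: inv_mult_group m_assoc)
    finally show ?thesis .
  qed
  moreover have "k \<in> verts \<tau> \<rightarrow> carrier G"
    using closed h by (auto simp: k_def)
  ultimately show ?thesis
    by (auto simp: gauge_equivalent_def)
qed

end

section \<open>Carrying paths across a flip\<close>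

lemma flip_path_append:
  assumes "flip_path P R p p'" "flip_path P R q q'"
  shows "flip_path P R (p @ q) (p' @ q')"
  using assms(1)
proof induction
  case nil
  then show ?case using assms(2) by simp
next
  case (outside d p p')
  then show ?case using flip_path.outside by simp
next
  case (passage r r' p p')
  then show ?case using flip_path.passage[of r r' P R "p @ q" "p' @ q'"] by simp
next
  case (inverse_passage r r' p p')
  then show ?case using flip_path.inverse_passage[of r r' P R "p @ q" "p' @ q'"] by simp
qed

lemma flip_path_single:
  "fst d \<notin> R \<Longrightarrow> flip_path P R [d] [d]"
  "(r, r') \<in> P \<Longrightarrow> flip_path P R r r'"
  "(r, r') \<in> P \<Longrightarrow> flip_path P R (reverse_path r) (reverse_path r')"
  by (rule flip_path.outside[OF _ flip_path.nil], assumption)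
    (use flip_path.passage[of r r' P R "[]" "[]"] flip_path.inverse_passage[of r r' P R "[]" "[]"]
      in \<open>simp_all add: flip_path.nil\<close>)

lemma flip_path_reverse:
  assumes "flip_path P R p p'"
  shows "flip_path P R (reverse_path p) (reverse_path p')"
  using assms
proof induction
  case nil
  show ?case by (simp add: flip_path.nil)
next
  case (outside d p p')
  then show ?case
    using flip_path_append[OF outside.IH flip_path_single(1)[of "rev_edge d"]] by simp
next
  case (passage r r' p p')
  then show ?case
    using flip_path_append[OF passage.IH flip_path_single(3)] by simp
next
  case (inverse_passage r r' p p')
  then show ?case
    using flip_path_append[OF inverse_passage.IH flip_path_single(2)] by simp
qed

text \<open>The part of a flip that matters for connections.  The oriented edges \<open>d1\<close>, \<open>d2\<close>, \<open>d3\<close>, \<open>d4\<close> carry the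
  orientation common to both graphs; \<open>e\<close> and \<open>f\<close> are the old and the new edge 5, whose orientations
  need not agree.  Only incidence is recorded, in the form of stars, because monodromies and gauge
  transformations depend on nothing else.\<close>

locale flip_region =
  fixes \<tau> \<tau>' :: "('v, 'e) fatgraph" and d1 d2 d3 d4 e f :: "'e oedge" and u v u' v' :: 'v
  assumes edges_eq: "edges \<tau>' = edges \<tau>"
    and sources: "source \<tau> ` oedges \<tau> \<subseteq> verts \<tau>"
    and connected: "\<And>x y. x \<in> verts \<tau> \<Longrightarrow> y \<in> verts \<tau> \<Longrightarrow> \<exists>p. is_path \<tau> x p y"
    and distinct: "distinct [fst d1, fst d2, fst d3, fst d4, fst e]"
    and flipped: "fst f = fst e"
    and star_u: "star \<tau> u = {e, rev_edge d3, rev_edge d4}"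
    and star_v: "star \<tau> v = {rev_edge e, d1, d2}"
    and star_u': "star \<tau>' u' = {f, rev_edge d3, d2}"
    and star_v': "star \<tau>' v' = {rev_edge f, rev_edge d4, d1}"
    and source_eq: "\<And>d. d \<in> oedges \<tau> - star \<tau> u - star \<tau> v \<Longrightarrow> source \<tau>' d = source \<tau> d"
    and verts_eq: "verts \<tau>' = verts \<tau> - {u, v} \<union> {u', v'}"
    and fresh: "u' \<notin> verts \<tau> - {u, v}" "v' \<notin> verts \<tau> - {u, v}"
begin

text \<open>\<open>R\<close> and \<open>P\<close> are the parameters of \<open>flip_path\<close> for this flip; \<open>W\<close> is the set of vertices common to
  both graphs, at which monodromies are compared.\<close>

abbreviation "R \<equiv> fst ` {d1, d2, d3, d4, e}"
abbreviation "P \<equiv> passages d1 d2 d3 d4 e f"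
abbreviation "W \<equiv> verts \<tau> - {u, v}"

lemma oedges_eq [simp]: "oedges \<tau>' = oedges \<tau>"
  by (simp add: oedges_def edges_eq)

lemma half_edges [simp]:
  "e \<in> oedges \<tau>" "d1 \<in> oedges \<tau>" "d2 \<in> oedges \<tau>" "d3 \<in> oedges \<tau>" "d4 \<in> oedges \<tau>" "f \<in> oedges \<tau>"
  "source \<tau> e = u" "target \<tau> e = v" "target \<tau> d3 = u" "target \<tau> d4 = u" "source \<tau> d1 = v" "source \<tau> d2 = v"
  "source \<tau>' f = u'" "target \<tau>' f = v'" "target \<tau>' d3 = u'" "target \<tau>' d4 = v'"
  "source \<tau>' d1 = v'" "source \<tau>' d2 = u'"
proof -
  have "{e, rev_edge d3, rev_edge d4} \<subseteq> star \<tau> u" "{rev_edge e, d1, d2} \<subseteq> star \<tau> v"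
    "{f, rev_edge d3, d2} \<subseteq> star \<tau>' u'" "{rev_edge f, rev_edge d4, d1} \<subseteq> star \<tau>' v'"
    using star_u star_v star_u' star_v' by simp_all
  then show "e \<in> oedges \<tau>" "d1 \<in> oedges \<tau>" "d2 \<in> oedges \<tau>" "d3 \<in> oedges \<tau>" "d4 \<in> oedges \<tau>" "f \<in> oedges \<tau>"
    "source \<tau> e = u" "target \<tau> e = v" "target \<tau> d3 = u" "target \<tau> d4 = u" "source \<tau> d1 = v" "source \<tau> d2 = v"
    "source \<tau>' f = u'" "target \<tau>' f = v'" "target \<tau>' d3 = u'" "target \<tau>' d4 = v'"
    "source \<tau>' d1 = v'" "source \<tau>' d2 = u'"
    unfolding star_def by simp_all
qed

lemma f_cases: "f = e \<or> f = rev_edge e"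
  using flipped by (auto simp: rev_edge_def prod_eq_iff)

lemma distinct_edges [simp]:
  "fst d1 \<noteq> fst d2" "fst d1 \<noteq> fst d3" "fst d1 \<noteq> fst d4" "fst d1 \<noteq> fst e" "fst d2 \<noteq> fst d3"
  "fst d2 \<noteq> fst d4" "fst d2 \<noteq> fst e" "fst d3 \<noteq> fst d4" "fst d3 \<noteq> fst e" "fst d4 \<noteq> fst e"
  using distinct by auto

lemma source_off_region:
  assumes "d \<in> oedges \<tau>" "d \<notin> {e, rev_edge e, rev_edge d3, rev_edge d4, d1, d2}"
  shows "source \<tau>' d = source \<tau> d" "source \<tau> d \<in> W"
proof -
  have *: "d \<notin> star \<tau> u" "d \<notin> star \<tau> v"
    using assms star_u star_v by auto
  then show "source \<tau>' d = source \<tau> d"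
    using source_eq assms by blast
  show "source \<tau> d \<in> W"
    using * assms sources by (auto simp: star_def)
qed

lemma ends_of_region [simp]:
  "source \<tau>' d3 = source \<tau> d3" "source \<tau>' d4 = source \<tau> d4"
  "target \<tau>' d1 = target \<tau> d1" "target \<tau>' d2 = target \<tau> d2"
  "source \<tau> d3 \<in> W" "source \<tau> d4 \<in> W" "target \<tau> d1 \<in> W" "target \<tau> d2 \<in> W"
proof -
  have neq: "d \<notin> {e, rev_edge e, rev_edge d3, rev_edge d4, d1, d2}"
    if "d \<in> {d3, d4, rev_edge d1, rev_edge d2}" for d
    using that distinct_edges distinct_edges[symmetric] rev_edge_simps(2,4,5) by (smt (verit) insertE singletonD)
  note off = source_off_region[OF _ neq]
  show "source \<tau>' d3 = source \<tau> d3" "source \<tau>' d4 = source \<tau> d4" "source \<tau> d3 \<in> W" "source \<tau> d4 \<in> W"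
    using off[of d3] off[of d4] by simp_all
  show "target \<tau>' d1 = target \<tau> d1" "target \<tau>' d2 = target \<tau> d2" "target \<tau> d1 \<in> W" "target \<tau> d2 \<in> W"
    using off[of "rev_edge d1"] off[of "rev_edge d2"] by simp_all
qed

lemma outside_region:
  assumes "d \<in> oedges \<tau>" "fst d \<notin> R"
  shows "source \<tau>' d = source \<tau> d" "target \<tau>' d = target \<tau> d" "source \<tau> d \<in> W" "target \<tau> d \<in> W"
proof -
  have *: "source \<tau>' d = source \<tau> d \<and> source \<tau> d \<in> W" if "d \<in> oedges \<tau>" "fst d \<notin> R" for d
  proof -
    have "d \<notin> {e, rev_edge e, rev_edge d3, rev_edge d4, d1, d2}"
      using that(2) by auto
    then show ?thesis using source_off_region[OF that(1)] by simp
  qed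
  show "source \<tau>' d = source \<tau> d" "target \<tau>' d = target \<tau> d" "source \<tau> d \<in> W" "target \<tau> d \<in> W"
    using *[of d] *[of "rev_edge d"] assms by simp_all
qed

lemma new_vertices: "u' \<noteq> v'"
proof
  assume "u' = v'"
  then have "f \<in> {rev_edge f, rev_edge d4, d1}"
    using star_u' star_v' by auto
  then show False
    using flipped by (metis distinct_edges(4,10) insertE rev_edge_simps(2,5) singletonD)
qed

lemma sources': "source \<tau>' ` oedges \<tau>' \<subseteq> verts \<tau>'"
proof -
  have "source \<tau>' d \<in> verts \<tau>'" if "d \<in> oedges \<tau>" for d
  proof (cases "d \<in> {e, rev_edge e, rev_edge d3, rev_edge d4, d1, d2}")
    case True
    then have "d \<in> {f, rev_edge f, rev_edge d3, rev_edge d4, d1, d2}"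
      using f_cases by auto
    then show ?thesis by (auto simp: verts_eq)
  next
    case False
    then show ?thesis using source_off_region[OF that] by (simp add: verts_eq)
  qed
  then show ?thesis by auto
qed

text \<open>Everything shown for edges below is stable under reversal, so one orientation of each edge is
  enough, and for the flipped edge it may be given by \<open>e\<close> or by \<open>f\<close>.\<close>

lemma oedge_induct [consumes 1, case_names outside d1 d2 d3 d4 flipped reverse]:
  assumes "d \<in> oedges \<tau>"
    and out: "\<And>d. d \<in> oedges \<tau> \<Longrightarrow> fst d \<notin> R \<Longrightarrow> Q d"
    and "Q d1" "Q d2" "Q d3" "Q d4" and flipped_edge: "Q e \<or> Q f"
    and rev: "\<And>d. d \<in> oedges \<tau> \<Longrightarrow> Q d \<Longrightarrow> Q (rev_edge d)"
  shows "Q d"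
proof (cases "fst d \<in> R")
  case True
  have "Q e"
    using flipped_edge f_cases rev[of f] by auto
  have "d \<in> S \<or> rev_edge d \<in> S" if m: "fst d \<in> fst ` S" for S :: "'e oedge set"
  proof -
    obtain s where "s \<in> S" "fst d = fst s" using m by (rule imageE)
    then have "s \<in> S \<and> (d = s \<or> rev_edge d = s)"
      by (cases "snd d = snd s") (auto simp: rev_edge_def prod_eq_iff)
    then show ?thesis by auto
  qed
  from this[OF True] have "d \<in> {d1, d2, d3, d4, e} \<or> rev_edge d \<in> {d1, d2, d3, d4, e}" .
  then show ?thesis
    using assms(3-6) \<open>Q e\<close> rev[of "rev_edge d"] assms(1) by auto
qed (use out assms(1) in blast)

lemma passage_is_path:
  assumes "(r, r') \<in> P" "is_path \<tau> x r y"
  shows "is_path \<tau>' x r' y" "x \<in> W" "y \<in> W" "set r' \<subseteq> oedges \<tau>"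
proof -
  have "is_path \<tau>' x r' y \<and> x \<in> W \<and> y \<in> W \<and> set r' \<subseteq> oedges \<tau>"
    using assms unfolding passages_def
    by (elim insertE emptyE; clarsimp simp: verts_eq; use ends_of_region(5-8) in auto)
  then show "is_path \<tau>' x r' y" "x \<in> W" "y \<in> W" "set r' \<subseteq> oedges \<tau>" by auto
qed

lemma flip_path_is_path:
  assumes "flip_path P R p p'" "is_path \<tau> x p y" "y \<in> W"
  shows "is_path \<tau>' x p' y"
  using assms
proof (induction arbitrary: x)
  case nil
  then show ?case by (auto simp: verts_eq)
next
  case (outside d p p')
  then show ?case using outside_region[of d] by auto
next
  case (passage r r' p p')
  then obtain z where "is_path \<tau> x r z" "is_path \<tau> z p y"
    by (auto simp: is_path_append[OF sources])
  then show ?case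
    using passage passage_is_path(1)[of r r'] by (auto simp: is_path_append[OF sources'])
next
  case (inverse_passage r r' p p')
  then obtain z where z: "is_path \<tau> x (reverse_path r) z" "is_path \<tau> z p y"
    by (auto simp: is_path_append[OF sources])
  have "is_path \<tau>' x (reverse_path r') z"
    using is_path_reverse[OF sources' passage_is_path(1)[OF inverse_passage.hyps(1)]]
      is_path_reverse[OF sources z(1)] by simp
  then show ?case
    using inverse_passage z by (auto simp: is_path_append[OF sources'])
qed

text \<open>A path of \<open>\<tau>\<close> may backtrack inside the flip region, where it has no image under \<open>flip_path\<close>.  It is
  followed edge by edge instead, after sending both ends of the old edge to \<open>u'\<close>.\<close>

lemma connected':
  assumes "x \<in> W" "y \<in> verts \<tau>'"
  shows "\<exists>p. is_path \<tau>' x p y"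
proof -
  define \<phi> where "\<phi> w = (if w \<in> {u, v} then u' else w)" for w
  have \<phi>: "\<phi> u = u'" "\<phi> v = u'" "\<And>w. w \<in> W \<Longrightarrow> \<phi> w = w"
    by (auto simp: \<phi>_def)
  have [simp]: "u' \<in> verts \<tau>'" "v' \<in> verts \<tau>'" "\<And>w. w \<in> W \<Longrightarrow> w \<in> verts \<tau>'"
    by (auto simp: verts_eq)
  note [simp] = \<phi>(1,2) \<phi>(3)[OF ends_of_region(5)] \<phi>(3)[OF ends_of_region(6)]
    \<phi>(3)[OF ends_of_region(7)] \<phi>(3)[OF ends_of_region(8)]
  have ends: "source \<tau> d3 \<in> verts \<tau>'" "source \<tau> d4 \<in> verts \<tau>'" "target \<tau> d1 \<in> verts \<tau>'" "target \<tau> d2 \<in> verts \<tau>'"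
    using ends_of_region by simp_all
  have edge: "\<exists>p. is_path \<tau>' (\<phi> (source \<tau> d)) p (\<phi> (target \<tau> d))" if "d \<in> oedges \<tau>" for d
    using that
  proof (induction d rule: oedge_induct)
    case (outside d)
    then show ?case
      using outside_region[of d] \<phi>(3) by (intro exI[of _ "[d]"]) simp
  next
    case d1
    show ?case using ends by (intro exI[of _ "[f, d1]"]) simp
  next
    case d2
    show ?case using ends by (intro exI[of _ "[d2]"]) simp
  next
    case d3
    show ?case using ends by (intro exI[of _ "[d3]"]) simp
  next
    case d4
    show ?case using ends by (intro exI[of _ "[d4, rev_edge f]"]) simp
  next
    case flipped
    have "is_path \<tau>' (\<phi> (source \<tau> e)) [] (\<phi> (target \<tau> e))" by simp
    then show ?case by blast
  next
    case (reverse d)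
    then show ?case using is_path_reverse[OF sources'] by auto
  qed
  have path: "\<exists>p'. is_path \<tau>' (\<phi> x) p' (\<phi> y)" if "is_path \<tau> x p y" for x p y
    using that
  proof (induction p arbitrary: x)
    case Nil
    then show ?case by (intro exI[of _ "[]"]) (auto simp: \<phi>_def verts_eq)
  next
    case (Cons d p)
    then have d: "d \<in> oedges \<tau>" "source \<tau> d = x" "is_path \<tau> (target \<tau> d) p y"
      by simp_all
    obtain p' where "is_path \<tau>' (\<phi> x) p' (\<phi> (target \<tau> d))"
      using edge[OF d(1)] d(2) by blast
    moreover obtain p'' where "is_path \<tau>' (\<phi> (target \<tau> d)) p'' (\<phi> y)"
      using Cons.IH[OF d(3)] by blast
    ultimately show ?case using is_path_append[OF sources'] by blast
  qed
  have to: "\<exists>p. is_path \<tau>' x p (\<phi> z)" if z: "z \<in> verts \<tau>" for z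
    using connected[of x z] path[of x _ z] assms(1) z \<phi>(3) by force
  have "u \<in> verts \<tau>"
    using sources half_edges(1,7) by blast
  from to[OF this] obtain p where p: "is_path \<tau>' x p u'"
    by auto
  have "is_path \<tau>' u' [f] v'"
    by simp
  with p have "is_path \<tau>' x (p @ [f]) v'"
    using is_path_append[OF sources'] by blast
  with p show ?thesis
    using to[of y] assms(2) \<phi>(3)[of y] by (auto simp: verts_eq)
qed

end

text \<open>Agreement off the flip region and on each passage propagates to all corresponding paths, which are
  composed of such pieces.\<close>

locale flip_connection = flip_region \<tau> \<tau>' d1 d2 d3 d4 e f u v u' v' + group G
  for \<tau> \<tau>' :: "('v, 'e) fatgraph" and d1 d2 d3 d4 e f u v u' v' and G (structure) +
  fixes A A' :: "'e oedge \<Rightarrow> 'b"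
  assumes conn: "graph_connection G \<tau> A" and conn': "graph_connection G \<tau>' A'"
    and agree_outside: "\<And>d. d \<in> oedges \<tau> \<Longrightarrow> fst d \<notin> R \<Longrightarrow> A' d = A d"
    and agree_passage: "\<And>r r'. (r, r') \<in> P \<Longrightarrow> monodromy G A' r' = monodromy G A r"
begin

lemma passage_oedges:
  assumes "(r, r') \<in> P"
  shows "set r \<subseteq> oedges \<tau>" "set r' \<subseteq> oedges \<tau>'"
  using assms unfolding passages_def by (elim insertE emptyE; simp)+

lemma set_reverse_path: "set p \<subseteq> oedges \<tau> \<Longrightarrow> set (reverse_path p) \<subseteq> oedges \<tau>"
  by (auto simp: reverse_path_def)

lemma flip_path_monodromy:
  assumes "flip_path P R p p'" "set p \<subseteq> oedges \<tau>"
  shows "set p' \<subseteq> oedges \<tau>'" "monodromy G A' p' = monodromy G A p"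
proof -
  have "set p' \<subseteq> oedges \<tau>' \<and> monodromy G A' p' = monodromy G A p"
    using assms
  proof induction
    case (passage r r' p p')
    then show ?case
      using passage_oedges[of r r'] agree_passage[of r r']
      by (simp add: monodromy_append[OF conn] monodromy_append[OF conn'])
  next
    case (inverse_passage r r' p p')
    then show ?case
      using passage_oedges[of r r'] set_reverse_path[of r] set_reverse_path[of r'] agree_passage[of r r']
      by (simp add: monodromy_append[OF conn] monodromy_append[OF conn']
        monodromy_reverse[OF conn] monodromy_reverse[OF conn'])
  qed (auto simp: agree_outside)
  then show "set p' \<subseteq> oedges \<tau>'" "monodromy G A' p' = monodromy G A p" by auto
qed

text \<open>Each end of the new edge is joined to a vertex outside the flip region by the path \<open>tail\<close>, which
  ends at \<open>base\<close> and consists of one edge; a common vertex has the empty tail.\<close>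

definition base :: "'v \<Rightarrow> 'v" where
  "base w = (if w = u' then source \<tau> d3 else if w = v' then source \<tau> d4 else w)"

definition tail :: "'v \<Rightarrow> 'e oedge list" where
  "tail w = (if w = u' then [rev_edge d3] else if w = v' then [rev_edge d4] else [])"

lemma base_tail_simps [simp]:
  "base u' = source \<tau> d3" "base v' = source \<tau> d4" "w \<in> W \<Longrightarrow> base w = w"
  "tail u' = [rev_edge d3]" "tail v' = [rev_edge d4]" "w \<in> W \<Longrightarrow> tail w = []"
  using fresh new_vertices by (auto simp: base_def tail_def)

lemma tail_oedges: "set (tail w) \<subseteq> oedges \<tau>"
  unfolding tail_def by (cases "w = u'"; cases "w = v'"; simp)

text \<open>After prolonging a path \<open>q\<close> of \<open>\<tau>'\<close> at both ends by tails, it starts and ends outside the flip region,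
  and up to homotopy it is the image \<open>p'\<close> of a path \<open>p\<close> of \<open>\<tau>\<close>.  Since \<open>q\<close> may backtrack and \<open>p'\<close> need not
  equal the prolonged path, homotopy is replaced by equality of the monodromies of every connection.\<close>

definition carried :: "'v \<Rightarrow> 'e oedge list \<Rightarrow> 'v \<Rightarrow> bool" where
  "carried x q y \<longleftrightarrow> (\<exists>p p'. flip_path P R p p' \<and> is_path \<tau> (base x) p (base y) \<and>
     (\<forall>B. graph_connection G \<tau>' B \<longrightarrow> monodromy G B p' =
        monodromy G B (tail y) \<otimes> monodromy G B q \<otimes> inv (monodromy G B (tail x))))"

lemma carried_reverse:
  assumes "carried x q y" "set q \<subseteq> oedges \<tau>"
  shows "carried y (reverse_path q) x"
proof -
  obtain p p' where p: "flip_path P R p p'" "is_path \<tau> (base x) p (base y)"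
    and mon: "\<And>B. graph_connection G \<tau>' B \<Longrightarrow> monodromy G B p' =
        monodromy G B (tail y) \<otimes> monodromy G B q \<otimes> inv (monodromy G B (tail x))"
    using assms(1) by (auto simp: carried_def)
  have p': "set p' \<subseteq> oedges \<tau>'"
    using flip_path_monodromy(1)[OF p(1) is_path_oedges[OF p(2)]] .
  have "monodromy G B (reverse_path p') =
        monodromy G B (tail x) \<otimes> monodromy G B (reverse_path q) \<otimes> inv (monodromy G B (tail y))"
    if "graph_connection G \<tau>' B" for B
    using that p' mon[OF that] assms(2) monodromy_closed[OF that] tail_oedges
    by (simp add: monodromy_reverse inv_mult_group m_assoc)
  then show ?thesis
    using flip_path_reverse[OF p(1)] is_path_reverse[OF sources p(2)] unfolding carried_def by blast
qed

lemma carried_append: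
  assumes "carried x q y" "carried y r z" "set q \<subseteq> oedges \<tau>" "set r \<subseteq> oedges \<tau>"
  shows "carried x (q @ r) z"
proof -
  obtain p p' where p: "flip_path P R p p'" "is_path \<tau> (base x) p (base y)"
    and monp: "\<And>B. graph_connection G \<tau>' B \<Longrightarrow> monodromy G B p' =
        monodromy G B (tail y) \<otimes> monodromy G B q \<otimes> inv (monodromy G B (tail x))"
    using assms(1) by (auto simp: carried_def)
  obtain s s' where s: "flip_path P R s s'" "is_path \<tau> (base y) s (base z)"
    and mons: "\<And>B. graph_connection G \<tau>' B \<Longrightarrow> monodromy G B s' =
        monodromy G B (tail z) \<otimes> monodromy G B r \<otimes> inv (monodromy G B (tail y))"
    using assms(2) by (auto simp: carried_def)
  have sets: "set p' \<subseteq> oedges \<tau>'" "set s' \<subseteq> oedges \<tau>'"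
    using flip_path_monodromy(1)[OF p(1) is_path_oedges[OF p(2)]]
      flip_path_monodromy(1)[OF s(1) is_path_oedges[OF s(2)]] by auto
  have "monodromy G B (p' @ s') =
        monodromy G B (tail z) \<otimes> monodromy G B (q @ r) \<otimes> inv (monodromy G B (tail x))"
    if "graph_connection G \<tau>' B" for B
    using that sets monp[OF that] mons[OF that] assms(3,4) monodromy_closed[OF that] tail_oedges
    by (simp add: monodromy_append[OF that] m_assoc cancel_inv_left)
  then show ?thesis
    using flip_path_append[OF p(1) s(1)] p(2) s(2) is_path_append[OF sources]
    unfolding carried_def by blast
qed

text \<open>Prolonged by tails, the edges 1, 2 and 5 of \<open>\<tau>'\<close> become the images of three of the passages, whereas
  edges 3 and 4 become edges followed by their reverse, which are homotopic to the empty path.\<close>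

lemma carried_edge:
  assumes "d \<in> oedges \<tau>"
  shows "carried (source \<tau>' d) [d] (target \<tau>' d)"
  using assms
proof (induction d rule: oedge_induct)
  case (outside d)
  then have "flip_path P R [d] [d]"
    by (simp add: flip_path_single(1))
  moreover have "target \<tau> d \<in> verts \<tau>"
    using outside_region[OF outside] by simp
  ultimately show ?case
    using outside_region[OF outside] outside(1) unfolding carried_def
    by (intro exI[of _ "[d]"]) (simp add: graph_connection_closed)
next
  case d1
  have "([d4, e, d1], [d4, d1]) \<in> P"
    by (simp add: passages_def)
  then show ?case
    unfolding carried_def using ends_of_region
    by (intro exI[of _ "[d4, e, d1]"] exI[of _ "[d4, d1]"] conjI flip_path_single(2))
      (auto simp: graph_connection_closed)
next
  case d2
  have "([d3, e, d2], [d3, d2]) \<in> P"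
    by (simp add: passages_def)
  then show ?case
    unfolding carried_def using ends_of_region
    by (intro exI[of _ "[d3, e, d2]"] exI[of _ "[d3, d2]"] conjI flip_path_single(2))
      (auto simp: graph_connection_closed)
next
  case d3
  show ?case
    unfolding carried_def using ends_of_region
    by (intro exI[of _ "[]"] conjI flip_path.nil) (auto simp: graph_connection_closed)
next
  case d4
  show ?case
    unfolding carried_def using ends_of_region
    by (intro exI[of _ "[]"] conjI flip_path.nil) (auto simp: graph_connection_closed)
next
  case flipped
  have "([d3, rev_edge d4], [d3, f, rev_edge d4]) \<in> P"
    by (simp add: passages_def)
  then have "carried (source \<tau>' f) [f] (target \<tau>' f)"
    unfolding carried_def using ends_of_region
    by (intro exI[of _ "[d3, rev_edge d4]"] exI[of _ "[d3, f, rev_edge d4]"] conjI flip_path_single(2))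
      (auto simp: graph_connection_closed m_assoc)
  then show ?case ..
next
  case (reverse d)
  then show ?case
    using carried_reverse[of "source \<tau>' d" "[d]"] by simp
qed

lemma carried_path:
  assumes "q \<noteq> []" "is_path \<tau>' x q y"
  shows "carried x q y"
  using assms
proof (induction q arbitrary: x rule: list_nonempty_induct)
  case (single d)
  have "d \<in> oedges \<tau>" "source \<tau>' d = x" "target \<tau>' d = y"
    using single.prems by simp_all
  then show ?case using carried_edge[of d] by simp
next
  case (cons d q)
  have d: "d \<in> oedges \<tau>" "source \<tau>' d = x" "is_path \<tau>' (target \<tau>' d) q y"
    using cons.prems by simp_all
  have "set [d] \<subseteq> oedges \<tau>" "set q \<subseteq> oedges \<tau>"
    using d(1) is_path_oedges[OF d(3)] by simp_all
  from carried_append[OF carried_edge[OF d(1)] cons.IH[OF d(3)] this] show ?case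
    unfolding d(2) by simp
qed

text \<open>A connection gauge equivalent to \<open>A'\<close> lies in the flip image because carrying paths preserves
  monodromies.  Conversely, a connection in the flip image has monodromies conjugate to those of \<open>A'\<close>
  along images of cycles of \<open>\<tau>\<close>, hence along all cycles at a common vertex, as all of them are
  carried; so it is gauge equivalent to \<open>A'\<close>.\<close>

lemma gauge_class_eq_flip_image:
  "gauge_class G \<tau>' A' = flip_image G \<tau> \<tau>' d1 d2 d3 d4 e f A"
proof (intro equalityI subsetI)
  fix B assume "B \<in> gauge_class G \<tau>' A'"
  then obtain h where B: "graph_connection G \<tau>' B" and h: "h \<in> verts \<tau>' \<rightarrow> carrier G"
    and gauge: "\<And>d. d \<in> oedges \<tau>' \<Longrightarrow> B d = inv (h (target \<tau>' d)) \<otimes> A' d \<otimes> h (source \<tau>' d)"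
    by (auto simp: gauge_class_def gauge_equivalent_def)
  have "monodromy G B p' = inv (h x) \<otimes> monodromy G A p \<otimes> inv (inv (h x)) \<and> inv (h x) \<in> carrier G"
    if x: "x \<in> W" and p: "is_path \<tau> x p x" "flip_path P R p p'" for x p p'
  proof -
    have "h x \<in> carrier G"
      using h x by (auto simp: verts_eq)
    then show ?thesis
      using monodromy_gauge[OF conn' h gauge sources' flip_path_is_path[OF p(2,1) x]]
        flip_path_monodromy(2)[OF p(2) is_path_oedges[OF p(1)]] by simp
  qed
  moreover have "inv (h x) \<in> carrier G" if "x \<in> W" for x
    using h that by (auto simp: verts_eq)
  ultimately show "B \<in> flip_image G \<tau> \<tau>' d1 d2 d3 d4 e f A"
    using B unfolding flip_image_def half_edges(7,8) by blast
next
  fix B assume B: "B \<in> flip_image G \<tau> \<tau>' d1 d2 d3 d4 e f A"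
  then have conB: "graph_connection G \<tau>' B"
    by (simp add: flip_image_def)
  \<comment> \<open>any vertex outside the flip region would do as base point\<close>
  let ?x = "source \<tau> d3"
  have x: "?x \<in> W" by (rule ends_of_region)
  obtain h where h: "h \<in> carrier G"
    and mon: "\<And>p p'. is_path \<tau> ?x p ?x \<Longrightarrow> flip_path P R p p' \<Longrightarrow>
      monodromy G B p' = h \<otimes> monodromy G A p \<otimes> inv h"
    using B x unfolding flip_image_def half_edges(7,8) by blast
  have "monodromy G B q = h \<otimes> monodromy G A' q \<otimes> inv h" if q: "is_path \<tau>' ?x q ?x" for q
  proof (cases "q = []")
    case True
    then show ?thesis using h by simp
  next
    case False
    obtain p p' where p: "flip_path P R p p'" "is_path \<tau> ?x p ?x"
      and eq: "\<And>C. graph_connection G \<tau>' C \<Longrightarrow> monodromy G C p' = \<one> \<otimes> monodromy G C q \<otimes> inv \<one>"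
      using carried_path[OF False q] x unfolding carried_def by auto
    have q': "set q \<subseteq> oedges \<tau>'"
      by (rule is_path_oedges[OF q])
    have "monodromy G B q = monodromy G B p'"
      using eq[OF conB] conB q' by simp
    also have "\<dots> = h \<otimes> monodromy G A' p' \<otimes> inv h"
      using mon[OF p(2,1)] flip_path_monodromy(2)[OF p(1) is_path_oedges[OF p(2)]] by simp
    also have "\<dots> = h \<otimes> monodromy G A' q \<otimes> inv h"
      using eq[OF conn'] conn' q' by simp
    finally show ?thesis .
  qed
  then have "gauge_equivalent G \<tau>' A' B"
    using gauge_equivalent_if_conjugate_monodromies[OF conn' conB sources' connected'[OF x] h] by blast
  then show "B \<in> gauge_class G \<tau>' A'"
    using conB by (simp add: gauge_class_def)
qed

end

section \<open>The flip region of a flip of trivalent fatgraphs\<close>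

lemma orbit_of_card_3:
  assumes "x \<in> orbit f x" "card (orbit f x) = 3"
  shows "orbit f x = {x, f x, f (f x)}"
proof -
  have "card (orbit f x) = funpow_dist1 f x x"
    using card_image[OF inj_on_funpow_dist1[OF assms(1)]] orbit_conv_funpow_dist1[OF assms(1)] by simp
  then have "orbit f x = (\<lambda>n. (f ^^ n) x) ` {0..<3}"
    using orbit_conv_funpow_dist1[OF assms(1)] assms(2) by simp
  also have "{0..<3} = {0, 1, 2::nat}"
    by auto
  finally show ?thesis
    by (simp add: numeral_2_eq_2)
qed

text \<open>At a trivalent vertex, \<open>nxt\<close> applied twice exhausts the vertex; this turns the cyclic orderings in
  \<open>is_flip\<close> into stars.\<close>

lemma star_trivalent:
  assumes "fatgraph \<tau>" "trivalent \<tau>" "d \<in> oedges \<tau>"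
  shows "star \<tau> (source \<tau> d) = {d, nxt \<tau> d, nxt \<tau> (nxt \<tau> d)}"
proof -
  have orbit: "orbit (nxt \<tau>) d = star \<tau> (source \<tau> d)"
    using assms unfolding fatgraph_def by blast
  have "source \<tau> d \<in> verts \<tau>"
    using assms unfolding fatgraph_def by blast
  then have "card (star \<tau> (source \<tau> d)) = 3"
    using assms(2) unfolding trivalent_def by blast
  moreover have "d \<in> star \<tau> (source \<tau> d)"
    using assms(3) by (simp add: star_def)
  ultimately show ?thesis
    using orbit_of_card_3[of d "nxt \<tau>"] orbit by simp
qed

lemma star_eqI:
  assumes "finite (star \<tau> v)" "card (star \<tau> v) \<le> 3"
    "{a, b, c} \<subseteq> star \<tau> v" "distinct [a, b, c]"
  shows "star \<tau> v = {a, b, c}"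
  using card_seteq[OF assms(1,3)] assms(2,4) by simp

text \<open>The six half-edges at the ends of edge 5 are the same before and after the flip, and no edge other
  than 5 has both of its half-edges among them.  So in \<open>\<tau>'\<close> edges 1 to 4 meet the ends of edge 5 with the
  half-edges with which they did in \<open>\<tau>\<close>, which forces \<open>\<omega>'\<close> to agree with \<open>\<omega>\<close> on them, and the
  incidences assumed for \<open>\<tau>'\<close> then determine the stars of its two new vertices.\<close>

lemma flip_region_if_is_flip:
  fixes \<omega> \<omega>' :: "'e \<Rightarrow> bool"
  assumes fat: "fatgraph \<tau>" and tri: "trivalent \<tau>" and flip: "is_flip \<tau> e5 \<tau>'"
    and dist: "distinct [e1, e2, e3, e4, e5]" and edges: "{e1, e2, e3, e4, e5} \<subseteq> edges \<tau>"
    and \<tau>: "target \<tau> (e3, \<omega> e3) = u" "target \<tau> (e4, \<omega> e4) = u" "source \<tau> (e5, \<omega> e5) = u"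
      "target \<tau> (e5, \<omega> e5) = v" "source \<tau> (e1, \<omega> e1) = v" "source \<tau> (e2, \<omega> e2) = v"
    and \<tau>': "target \<tau>' (e3, \<omega>' e3) = u'" "source \<tau>' (e2, \<omega>' e2) = u'"
      "target \<tau>' (e4, \<omega>' e4) = v'" "source \<tau>' (e1, \<omega>' e1) = v'"
      "source \<tau>' (e5, \<omega>' e5) = u'" "target \<tau>' (e5, \<omega>' e5) = v'"
  shows "flip_region \<tau> \<tau>' (e1, \<omega> e1) (e2, \<omega> e2) (e3, \<omega> e3) (e4, \<omega> e4) (e5, \<omega> e5) (e5, \<omega>' e5) u v u' v'"
    and "\<omega>' e1 = \<omega> e1" "\<omega>' e2 = \<omega> e2" "\<omega>' e3 = \<omega> e3" "\<omega>' e4 = \<omega> e4"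
proof -
  let ?d1 = "(e1, \<omega> e1)" and ?d2 = "(e2, \<omega> e2)" and ?d3 = "(e3, \<omega> e3)" and ?d4 = "(e4, \<omega> e4)"
    and ?e = "(e5, \<omega> e5)" and ?f = "(e5, \<omega>' e5)"
  define x y where "x = (e5, True)" and "y = (e5, False)"
  define A where "A = nxt \<tau> x"
  define B where "B = nxt \<tau> A"
  define C where "C = nxt \<tau> y"
  define D where "D = nxt \<tau> C"
  define S where "S = {?e, rev_edge ?e, rev_edge ?d3, rev_edge ?d4, ?d1, ?d2}"
  have xy: "{x, y} = {?e, rev_edge ?e}" "{x, y} = {?f, rev_edge ?f}"
    by (cases "\<omega> e5"; auto simp: x_def y_def rev_edge_def) (cases "\<omega>' e5"; auto simp: x_def y_def rev_edge_def)
  have sources: "source \<tau> ` oedges \<tau> \<subseteq> verts \<tau>"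
    using fat unfolding fatgraph_def by blast
  have oedges: "(a, b) \<in> oedges \<tau>" if "a \<in> edges \<tau>" for a and b :: bool
    using that by (simp add: oedges_def)
  have "source \<tau> x \<noteq> source \<tau> y" "edges \<tau>' = edges \<tau>"
    using flip unfolding is_flip_def x_def y_def Let_def by blast+
  define V where "V = verts \<tau> - {source \<tau> x, source \<tau> y}"
  have "\<exists>p q x' y'. {x', y'} = {x, y} \<and> p \<noteq> q \<and> p \<notin> V \<and> q \<notin> V \<and> verts \<tau>' = V \<union> {p, q} \<and>
            source \<tau>' x' = p \<and> source \<tau>' D = p \<and> source \<tau>' A = p \<and>
            nxt \<tau>' x' = D \<and> nxt \<tau>' D = A \<and> nxt \<tau>' A = x' \<and>
            source \<tau>' y' = q \<and> source \<tau>' B = q \<and> source \<tau>' C = q \<and>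
            nxt \<tau>' y' = B \<and> nxt \<tau>' B = C \<and> nxt \<tau>' C = y'"
    using flip unfolding is_flip_def Let_def x_def y_def A_def B_def C_def D_def V_def by blast
  then obtain p q x' y' where x'y': "{x', y'} = {x, y}" and pq: "p \<noteq> q" "p \<notin> V" "q \<notin> V"
    "verts \<tau>' = V \<union> {p, q}" and p: "source \<tau>' x' = p" "source \<tau>' D = p" "source \<tau>' A = p"
    and q: "source \<tau>' y' = q" "source \<tau>' B = q" "source \<tau>' C = q"
    by blast
  have same: "\<forall>d\<in>oedges \<tau> - {x, y, A, B, C, D}. source \<tau>' d = source \<tau> d"
    using flip unfolding is_flip_def Let_def x_def y_def A_def B_def C_def D_def by blast
  have card_star: "finite (star \<tau> w)" "card (star \<tau> w) \<le> 3" if "w \<in> {u, v}" for w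
  proof -
    have "source \<tau> ?e \<in> verts \<tau>" "source \<tau> ?d1 \<in> verts \<tau>"
      using sources edges oedges[of e5] oedges[of e1] by auto
    then have "w \<in> verts \<tau>"
      using that unfolding \<tau>(3,5) by auto
    then show "card (star \<tau> w) \<le> 3"
      using tri by (simp add: trivalent_def)
    have "finite (oedges \<tau>)"
      using fat by (simp add: fatgraph_def oedges_def)
    then show "finite (star \<tau> w)"
      by (rule rev_finite_subset) (auto simp: star_def)
  qed
  have star_u: "star \<tau> u = {?e, rev_edge ?d3, rev_edge ?d4}"
    using edges \<tau> oedges dist by (intro star_eqI card_star) (auto simp: star_def rev_edge_def target_def)
  have star_v: "star \<tau> v = {rev_edge ?e, ?d1, ?d2}"
    using edges \<tau> oedges dist by (intro star_eqI card_star) (auto simp: star_def rev_edge_def target_def)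
  have xy_oedges: "x \<in> oedges \<tau>" "y \<in> oedges \<tau>"
    using edges oedges by (auto simp: x_def y_def)
  have stars: "star \<tau> (source \<tau> x) = {x, A, B}" "star \<tau> (source \<tau> y) = {y, C, D}"
    unfolding A_def B_def C_def D_def by (intro star_trivalent fat tri xy_oedges)+
  \<comment> \<open>\<open>is_flip\<close> names the half-edges of edge 5 by \<open>True\<close> and \<open>False\<close>; which of them starts at \<open>u\<close> depends on \<open>\<omega>\<close>\<close>
  have ends: "{source \<tau> x, source \<tau> y} = {u, v}"
  proof -
    have "{source \<tau> x, source \<tau> y} = source \<tau> ` {x, y}" by simp
    also have "\<dots> = {u, v}" unfolding xy(1) using \<tau> by simp
    finally show ?thesis .
  qed
  have "star \<tau> u \<union> star \<tau> v = star \<tau> (source \<tau> x) \<union> star \<tau> (source \<tau> y)"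
    using ends by (auto simp: doubleton_eq_iff)
  then have S: "S = {x, y, A, B, C, D}" "S = star \<tau> u \<union> star \<tau> v"
    unfolding stars by (auto simp: star_u star_v S_def)
  have S_oedges: "S \<subseteq> oedges \<tau>"
    unfolding S(2) by (auto simp: star_def)
  have oedges': "oedges \<tau>' = oedges \<tau>"
    using \<open>edges \<tau>' = edges \<tau>\<close> by (simp add: oedges_def)
  have off: "source \<tau>' d = source \<tau> d" "source \<tau> d \<in> V" if "d \<in> oedges \<tau>" "d \<notin> S" for d
  proof -
    show "source \<tau>' d = source \<tau> d"
      using same that S(1) by blast
    have "source \<tau> d \<notin> {u, v}"
      using that unfolding S(2) by (auto simp: star_def)
    then show "source \<tau> d \<in> V"
      using sources that(1) unfolding V_def ends by blast
  qed
  have S': "S = {x', D, A} \<union> {y', B, C}"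
    unfolding S(1) using x'y' by auto
  have star_new: "star \<tau>' r = {d \<in> S. source \<tau>' d = r}" if "r \<notin> V" for r
  proof -
    have "d \<in> S" if "d \<in> oedges \<tau>" "source \<tau>' d = r" for d
      using off[OF that(1)] that(2) \<open>r \<notin> V\<close> by metis
    then show ?thesis
      using S_oedges unfolding star_def oedges' by blast
  qed
  have star_p: "star \<tau>' p = {x', D, A}" and star_q: "star \<tau>' q = {y', B, C}"
    unfolding star_new[OF pq(2)] star_new[OF pq(3)] S' using p q pq(1) by auto
  have new: "{u', v'} = {p, q}"
  proof -
    have "{u', v'} = source \<tau>' ` {?f, rev_edge ?f}" using \<tau>' by simp
    also have "\<dots> = source \<tau>' ` {x', y'}" using xy(2) x'y' by simp
    finally show ?thesis using p q by simp
  qed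
  have star_S: "finite (star \<tau>' w)" "card (star \<tau>' w) \<le> 3" "star \<tau>' w \<subseteq> S" if "w \<in> {u', v'}" for w
  proof -
    have "w = p \<or> w = q" using that unfolding new by simp
    then show "finite (star \<tau>' w)" "card (star \<tau>' w) \<le> 3" "star \<tau>' w \<subseteq> S"
      using star_p star_q S' by (auto simp: card_insert_if)
  qed
  have in_S: "rev_edge (e3, \<omega>' e3) \<in> S" "rev_edge (e4, \<omega>' e4) \<in> S" "(e1, \<omega>' e1) \<in> S" "(e2, \<omega>' e2) \<in> S"
  proof -
    have "d \<in> S" if "d \<in> oedges \<tau>" "source \<tau>' d \<in> {u', v'}" for d
      using star_S(3)[OF that(2)] that(1) by (auto simp: star_def oedges')
    then show "rev_edge (e3, \<omega>' e3) \<in> S" "rev_edge (e4, \<omega>' e4) \<in> S" "(e1, \<omega>' e1) \<in> S" "(e2, \<omega>' e2) \<in> S"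
      using \<tau>' edges oedges by simp_all
  qed
  show \<omega>: "\<omega>' e1 = \<omega> e1" "\<omega>' e2 = \<omega> e2" "\<omega>' e3 = \<omega> e3" "\<omega>' e4 = \<omega> e4"
    using in_S dist unfolding S_def by (auto simp: rev_edge_def)
  have star_u': "star \<tau>' u' = {?f, rev_edge ?d3, ?d2}"
    using edges \<tau>' oedges dist \<omega> oedges'
    by (intro star_eqI star_S) (auto simp: star_def rev_edge_def target_def)
  have star_v': "star \<tau>' v' = {rev_edge ?f, rev_edge ?d4, ?d1}"
    using edges \<tau>' oedges dist \<omega> oedges'
    by (intro star_eqI star_S) (auto simp: star_def rev_edge_def target_def)
  show "flip_region \<tau> \<tau>' ?d1 ?d2 ?d3 ?d4 ?e ?f u v u' v'"
  proof
    show "\<exists>p. is_path \<tau> a p b" if "a \<in> verts \<tau>" "b \<in> verts \<tau>" for a b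
      using fat that unfolding fatgraph_def by blast
    show "distinct [fst ?d1, fst ?d2, fst ?d3, fst ?d4, fst ?e]"
      using dist by simp
    show "source \<tau>' d = source \<tau> d" if "d \<in> oedges \<tau> - star \<tau> u - star \<tau> v" for d
      using off(1)[of d] that unfolding S(2) by blast
    show "verts \<tau>' = verts \<tau> - {u, v} \<union> {u', v'}"
      unfolding pq(4) new V_def ends ..
    show "u' \<notin> verts \<tau> - {u, v}" "v' \<notin> verts \<tau> - {u, v}"
      using new pq(2,3) unfolding V_def ends by (auto simp: doubleton_eq_iff)
  qed (fact sources star_u star_v star_u' star_v' | simp add: \<open>edges \<tau>' = edges \<tau>\<close>)+
qed

section \<open>Flipping coordinates\<close>

text \<open>The gauge transformation by \<open>p\<close> at \<open>u\<close> and by \<open>q\<close> at \<open>v\<close> moves these factors of \<open>A e\<close> to the four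
  adjacent edges and leaves \<open>m\<close> on edge 5.  The passages from 4 to 1 and from 3 to 2 cross edge 5 in
  \<open>\<tau>\<close> but not in \<open>\<tau>'\<close>, so edges 4 and 2 take over \<open>m\<close>; in the passage from 4 to 2, one of the two
  copies of \<open>m\<close> is then cancelled by \<open>inv m\<close> on \<open>f\<close> traversed backwards.\<close>

lemma (in group) passage_monodromies_if_factored:
  assumes A: "graph_connection G \<tau> A" and A': "graph_connection G \<tau>' A'"
    and d: "{d1, d2, d3, d4, e} \<subseteq> oedges \<tau>" and f: "f \<in> oedges \<tau>'"
    and "{d1, d2, d3, d4} \<subseteq> oedges \<tau>'"
    and [simp]: "q \<in> carrier G" "m \<in> carrier G" "p \<in> carrier G"
    and factor: "A e = q \<otimes> m \<otimes> p" and A'f: "A' f = m"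
    and slide: "A' d1 = A d1 \<otimes> q" "A' d2 = A d2 \<otimes> (q \<otimes> m)" "A' d3 = p \<otimes> A d3" "A' d4 = m \<otimes> p \<otimes> A d4"
    and r: "(r, r') \<in> passages d1 d2 d3 d4 e f"
  shows "monodromy G A' r' = monodromy G A r"
proof -
  have [simp]: "A d1 \<in> carrier G" "A d2 \<in> carrier G" "A d3 \<in> carrier G" "A d4 \<in> carrier G"
    using A d by (auto simp: graph_connection_closed)
  have inv: "A (rev_edge d2) = inv (A d2)" "A (rev_edge d4) = inv (A d4)"
    "A' (rev_edge d2) = inv (A' d2)" "A' (rev_edge d4) = inv (A' d4)" "A' (rev_edge f) = inv (A' f)"
    using graph_connection_closed(2)[OF A] graph_connection_closed(2)[OF A'] assms(3-5) by auto
  show ?thesis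
    using r unfolding passages_def
    by (elim insertE emptyE) (simp_all add: inv factor A'f slide inv_mult_group m_assoc cancel_inv_left)
qed

lemma coord_elem_closed:
  assumes "c \<in> coords N"
  shows "coord_elem c \<in> carrier (GL11 N)"
proof -
  obtain a b \<alpha> \<beta> where c: "c = (a, b, \<alpha>, \<beta>)" "a \<in> grassmann_pos N" "b \<in> grassmann_pos N"
    "\<alpha> \<in> grassmann_odd N" "\<beta> \<in> grassmann_odd N"
    using assms unfolding coords_def by auto
  show ?thesis
    using c(2-5) pos_inverse(1)[OF c(3)] unfolding c(1) coord_elem_entries[OF c(3,2,4,5)]
    by (auto simp: grassmann_pos_def body_odd)
qed

lemma graph_connection_coord:
  assumes "c \<in> coord_vectors N \<tau>"
  shows "graph_connection (GL11 N) \<tau> (coord_connection N \<omega> c)"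
proof -
  interpret group "GL11 N" by (rule group_GL11)
  have "coord_elem (c e) \<in> carrier (GL11 N)" if "e \<in> edges \<tau>" for e
    using that assms coord_elem_closed unfolding coord_vectors_def by blast
  then show ?thesis
    by (auto simp: graph_connection_def oedges_def rev_edge_def)
qed

theorem theorem5:
  fixes N g s :: nat
    and \<tau> \<tau>' :: "('v, 'e) fatgraph"
    and \<omega> \<omega>' :: "'e \<Rightarrow> bool"
    and e1 e2 e3 e4 e5 :: 'e
    and u v u' v' :: 'v
    and c :: "'e \<Rightarrow> coord"
    and a1 a2 a3 a4 a5 b1 b2 b3 b4 b5 :: grassmann
    and \<alpha>1 \<alpha>2 \<alpha>3 \<alpha>4 \<alpha>5 \<beta>1 \<beta>2 \<beta>3 \<beta>4 \<beta>5 :: grassmann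
  assumes "s \<ge> 1" and "2 * int g - 2 + int s > 0"
    and "fatgraph_of_surface g s \<tau>" and "trivalent \<tau>"
    and "is_flip \<tau> e5 \<tau>'"
    and "distinct [e1, e2, e3, e4, e5]" and "{e1, e2, e3, e4, e5} \<subseteq> edges \<tau>"
    and "target \<tau> (e3, \<omega> e3) = u" and "target \<tau> (e4, \<omega> e4) = u"
    and "source \<tau> (e5, \<omega> e5) = u" and "target \<tau> (e5, \<omega> e5) = v"
    and "source \<tau> (e1, \<omega> e1) = v" and "source \<tau> (e2, \<omega> e2) = v"
    and "target \<tau>' (e3, \<omega>' e3) = u'" and "source \<tau>' (e2, \<omega>' e2) = u'"
    and "target \<tau>' (e4, \<omega>' e4) = v'" and "source \<tau>' (e1, \<omega>' e1) = v'"
    and "source \<tau>' (e5, \<omega>' e5) = u'" and "target \<tau>' (e5, \<omega>' e5) = v'"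
    and "\<forall>e \<in> edges \<tau> - {e1, e2, e3, e4, e5}. \<omega>' e = \<omega> e"
    and "c \<in> coord_vectors N \<tau>"
    and "c e1 = (a1, b1, \<alpha>1, \<beta>1)" and "c e2 = (a2, b2, \<alpha>2, \<beta>2)"
    and "c e3 = (a3, b3, \<alpha>3, \<beta>3)" and "c e4 = (a4, b4, \<alpha>4, \<beta>4)"
    and "c e5 = (a5, b5, \<alpha>5, \<beta>5)"
  shows "\<exists>c' \<in> coord_vectors N \<tau>'.
      gauge_class (GL11 N) \<tau>' (coord_connection N \<omega>' c') =
        flip_image (GL11 N) \<tau> \<tau>' (e1, \<omega> e1) (e2, \<omega> e2) (e3, \<omega> e3) (e4, \<omega> e4)
          (e5, \<omega> e5) (e5, \<omega>' e5) (coord_connection N \<omega> c) \<and>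
      (\<forall>e \<in> edges \<tau>' - {e1, e2, e3, e4, e5}. c' e = c e) \<and>
      (let \<beta>1' = \<beta>1 + b5\<^sup>2 * \<beta>5;
           \<beta>2' = \<beta>5 + (inverse b5)\<^sup>2 * \<beta>2;
           \<alpha>3' = \<alpha>3 + b5\<^sup>2 * \<alpha>5;
           \<alpha>4' = (inverse b5)\<^sup>2 * \<alpha>4 + \<alpha>5;
           a1' = a1 * (1 - (1/2) *\<^sub>R (b1\<^sup>2 * b5\<^sup>2 * \<alpha>1 * \<beta>5));
           a3' = a3 * (1 - (1/2) *\<^sub>R (b3\<^sup>2 * b5\<^sup>2 * \<alpha>5 * \<beta>3));
           a5' = a5 * (1 - (1/2) *\<^sub>R (b5\<^sup>2 * \<alpha>5 * \<beta>5));
           a2' = a2 * a5 * (1 - (1/2) *\<^sub>R (b2\<^sup>2 * b5\<^sup>2 * \<alpha>2 * \<beta>5))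
                   * (1 - (1/2) *\<^sub>R (b5\<^sup>2 * \<alpha>5 * \<beta>5));
           a4' = a4 * a5 * (1 - (1/2) *\<^sub>R (b4\<^sup>2 * b5\<^sup>2 * \<alpha>5 * \<beta>4))
                   * (1 - (1/2) *\<^sub>R (b5\<^sup>2 * \<alpha>5 * \<beta>5))
       in c' e1 = (a1', b1, \<alpha>1, \<beta>1') \<and>
          c' e2 = (a2', b2 * b5, \<alpha>2, \<beta>2') \<and>
          c' e3 = (a3', b3, \<alpha>3', \<beta>3) \<and>
          c' e4 = (a4', b4 * b5, \<alpha>4', \<beta>4) \<and>
          c' e5 = (a5', b5, 0, 0))"
proof -
  note flip = assms(5-19) and coords = assms(22-26)
  let ?d1 = "(e1, \<omega> e1)" and ?d2 = "(e2, \<omega> e2)" and ?d3 = "(e3, \<omega> e3)" and ?d4 = "(e4, \<omega> e4)"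
    and ?e = "(e5, \<omega> e5)" and ?f = "(e5, \<omega>' e5)"
  have fat: "fatgraph \<tau>"
    using assms(3) by (simp add: fatgraph_of_surface_def)
  note region = flip_region_if_is_flip[OF fat assms(4) flip]
  interpret flip_region \<tau> \<tau>' ?d1 ?d2 ?d3 ?d4 ?e ?f u v u' v'
    by (rule region(1))
  interpret group "GL11 N" by (rule group_GL11)

  have c: "c e \<in> coords N" if "e \<in> {e1, e2, e3, e4, e5}" for e
    using that assms(7,21) unfolding coord_vectors_def by blast
  then have closed: "coord_elem (c e) \<in> carrier (GL11 N)" if "e \<in> {e1, e2, e3, e4, e5}" for e
    using that by (intro coord_elem_closed)
  from c[of e1] c[of e2] c[of e3] c[of e4] c[of e5]
  have pos: "a1 \<in> grassmann_pos N" "b1 \<in> grassmann_pos N" "a2 \<in> grassmann_pos N" "b2 \<in> grassmann_pos N"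
      "a3 \<in> grassmann_pos N" "b3 \<in> grassmann_pos N" "a4 \<in> grassmann_pos N" "b4 \<in> grassmann_pos N"
      "a5 \<in> grassmann_pos N" "b5 \<in> grassmann_pos N"
    and odd: "\<alpha>1 \<in> grassmann_odd N" "\<beta>1 \<in> grassmann_odd N" "\<alpha>2 \<in> grassmann_odd N" "\<beta>2 \<in> grassmann_odd N"
      "\<alpha>3 \<in> grassmann_odd N" "\<beta>3 \<in> grassmann_odd N" "\<alpha>4 \<in> grassmann_odd N" "\<beta>4 \<in> grassmann_odd N"
      "\<alpha>5 \<in> grassmann_odd N" "\<beta>5 \<in> grassmann_odd N"
    unfolding coords coords_def by simp_all
  note even = pos[THEN grassmann_posD]
  define i where "i = inverse b5"
  have i: "i \<in> grassmann_even N" "i * b5 = 1" "i \<in> grassmann_pos N"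
    using pos_inverse[OF pos(10)] by (auto simp: i_def grassmann_posD)
  have i_left: "i * (b5 * z) = z" for z
    using i(2) by (simp flip: mult.assoc)
  define \<beta> where "\<beta> = b5\<^sup>2 * \<beta>5"
  define \<alpha> where "\<alpha> = b5\<^sup>2 * \<alpha>5"
  have odd': "\<alpha> \<in> grassmann_odd N" "\<beta> \<in> grassmann_odd N"
    using even(10) odd by (simp_all add: \<alpha>_def \<beta>_def)

  define a1' where "a1' = a1 * (1 - (1/2) *\<^sub>R (b1\<^sup>2 * b5\<^sup>2 * \<alpha>1 * \<beta>5))"
  define a3' where "a3' = a3 * (1 - (1/2) *\<^sub>R (b3\<^sup>2 * b5\<^sup>2 * \<alpha>5 * \<beta>3))"
  define a5' where "a5' = a5 * (1 - (1/2) *\<^sub>R (b5\<^sup>2 * \<alpha>5 * \<beta>5))"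
  define a2' where "a2' = a2 * a5 * (1 - (1/2) *\<^sub>R (b2\<^sup>2 * b5\<^sup>2 * \<alpha>2 * \<beta>5))
                   * (1 - (1/2) *\<^sub>R (b5\<^sup>2 * \<alpha>5 * \<beta>5))"
  define a4' where "a4' = a4 * a5 * (1 - (1/2) *\<^sub>R (b4\<^sup>2 * b5\<^sup>2 * \<alpha>5 * \<beta>4))
                   * (1 - (1/2) *\<^sub>R (b5\<^sup>2 * \<alpha>5 * \<beta>5))"
  define \<beta>2' where "\<beta>2' = \<beta>5 + i\<^sup>2 * \<beta>2"
  define \<alpha>4' where "\<alpha>4' = i\<^sup>2 * \<alpha>4 + \<alpha>5"
  define c' where "c' = c(e1 := (a1', b1, \<alpha>1, \<beta>1 + \<beta>), e2 := (a2', b2 * b5, \<alpha>2, \<beta>2'),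
    e3 := (a3', b3, \<alpha>3 + \<alpha>, \<beta>3), e4 := (a4', b4 * b5, \<alpha>4', \<beta>4), e5 := (a5', b5, 0, 0))"
  have c': "c' e1 = (a1', b1, \<alpha>1, \<beta>1 + \<beta>)" "c' e2 = (a2', b2 * b5, \<alpha>2, \<beta>2')"
    "c' e3 = (a3', b3, \<alpha>3 + \<alpha>, \<beta>3)" "c' e4 = (a4', b4 * b5, \<alpha>4', \<beta>4)" "c' e5 = (a5', b5, 0, 0)"
    and c'_off: "\<And>e. e \<notin> {e1, e2, e3, e4, e5} \<Longrightarrow> c' e = c e"
    using assms(6) by (simp_all add: c'_def)
  have a': "a1' \<in> grassmann_pos N" "a2' \<in> grassmann_pos N" "a3' \<in> grassmann_pos N"
    "a4' \<in> grassmann_pos N" "a5' \<in> grassmann_pos N"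
    using pos odd unfolding a1'_def a2'_def a3'_def a4'_def a5'_def
    by (auto simp: grassmann_pos_def body_odd mult.assoc)
  have "c' \<in> coord_vectors N \<tau>'"
  proof -
    have "c' e \<in> coords N" if "e \<in> edges \<tau>" for e
    proof (cases "e \<in> {e1, e2, e3, e4, e5}")
      case True
      then show ?thesis
        using c' a' pos odd odd' i(1) grassmann_pos_mult[OF pos(4,10)] grassmann_pos_mult[OF pos(8,10)]
        unfolding coords_def \<beta>2'_def \<alpha>4'_def by auto
    next
      case False
      then show ?thesis
        using c'_off[OF False] that assms(21) unfolding coord_vectors_def by auto
    qed
    then show ?thesis
      by (simp add: coord_vectors_def edges_eq)
  qed
  \<comment> \<open>the lower, diagonal and upper factor of the element on edge 5\<close>
  define q where "q = SMat 1 0 \<beta> 1"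
  define p where "p = SMat 1 \<alpha> 0 1"
  define m where "m = coord_elem (a5', b5, 0, 0)"
  have qpm: "q \<in> carrier (GL11 N)" "m \<in> carrier (GL11 N)" "p \<in> carrier (GL11 N)"
  proof -
    show "q \<in> carrier (GL11 N)" "p \<in> carrier (GL11 N)"
      using odd' by (simp_all add: q_def p_def grassmann_pos_one)
    show "m \<in> carrier (GL11 N)"
      unfolding m_def by (rule coord_elem_closed) (use a' pos in \<open>simp add: coords_def\<close>)
  qed
  let ?A = "coord_connection N \<omega> c" and ?A' = "coord_connection N \<omega>' c'"
  have A: "graph_connection (GL11 N) \<tau> ?A" "graph_connection (GL11 N) \<tau>' ?A'"
    using graph_connection_coord assms(21) \<open>c' \<in> coord_vectors N \<tau>'\<close> by auto
  have factor: "coord_elem (c e5) = q \<otimes>\<^bsub>GL11 N\<^esub> m \<otimes>\<^bsub>GL11 N\<^esub> p"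
    using coord_elem_factor[OF pos(10,9) odd(9,10)]
    by (simp only: coords q_def m_def p_def \<alpha>_def \<beta>_def a5'_def mult.assoc GL11_simps)
  note even_simps = mult.assoc power2_eq_square even_ac[of _ N] even
  \<comment> \<open>edge 1 absorbs the lower factor at its start, edge 3 the upper factor at its end\<close>
  have slide1: "coord_elem (c' e1) = coord_elem (c e1) \<otimes>\<^bsub>GL11 N\<^esub> q"
  proof -
    have a1': "a1' = a1 * (1 - (1/2) *\<^sub>R (b1\<^sup>2 * (\<alpha>1 * \<beta>)))"
      unfolding a1'_def \<beta>_def by (simp add: even_simps)
    show ?thesis
      using coord_elem_mult_lower[OF pos(2,1) odd(1,2) odd'(2)]
      by (simp only: coords c' a1' q_def GL11_simps)
  qed
  have slide3: "coord_elem (c' e3) = p \<otimes>\<^bsub>GL11 N\<^esub> coord_elem (c e3)"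
  proof -
    have a3': "a3' = a3 * (1 - (1/2) *\<^sub>R (b3\<^sup>2 * (\<alpha> * \<beta>3)))"
      unfolding a3'_def \<alpha>_def by (simp add: even_simps)
    show ?thesis
      using coord_elem_upper_mult[OF pos(6,5) odd(5,6) odd'(1)]
      by (simp only: coords c' a3' p_def GL11_simps)
  qed
  \<comment> \<open>edges 2 and 4 absorb the diagonal factor as well, which rescales their odd coordinates\<close>
  have slide2: "coord_elem (c' e2) = coord_elem (c e2) \<otimes>\<^bsub>GL11 N\<^esub> (q \<otimes>\<^bsub>GL11 N\<^esub> m)"
  proof -
    define t where "t = 1 - (1/2) *\<^sub>R (b2\<^sup>2 * (\<alpha>2 * \<beta>))"
    have t: "t = 1 - (1/2) *\<^sub>R (b2\<^sup>2 * b5\<^sup>2 * \<alpha>2 * \<beta>5)"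
      unfolding t_def \<beta>_def by (simp add: even_simps)
    have t_pos: "a2 * t \<in> grassmann_pos N"
      unfolding t_def using pos odd odd' by (auto simp: grassmann_pos_def body_odd)
    have a2': "a2' = a2 * t * a5'"
      unfolding a2'_def a5'_def t[symmetric] by (simp only: mult.assoc even_ac(3)[OF even(9)])
    have \<beta>2': "\<beta>2' = (inverse b5)\<^sup>2 * (\<beta>2 + \<beta>)"
      unfolding \<beta>2'_def \<beta>_def i_def[symmetric]
      by (simp add: power2_eq_square distrib_left mult.assoc i_left i(2))
    have "coord_elem (c e2) \<otimes>\<^bsub>GL11 N\<^esub> (q \<otimes>\<^bsub>GL11 N\<^esub> m) =
        coord_elem (c e2) \<otimes>\<^bsub>GL11 N\<^esub> q \<otimes>\<^bsub>GL11 N\<^esub> m"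
      using qpm closed[of e2] by (simp add: m_assoc del: GL11_simps)
    also have "\<dots> = coord_elem (a2 * t, b2, \<alpha>2, \<beta>2 + \<beta>) \<otimes>\<^bsub>GL11 N\<^esub> m"
      using coord_elem_mult_lower[OF pos(4,3) odd(3,4) odd'(2)] by (simp only: coords GL11_simps q_def t_def)
    also have "\<dots> = coord_elem (c' e2)"
      using coord_elem_mult_diag(1)[OF pos(4) t_pos pos(10) a'(5) odd(3), of "\<beta>2 + \<beta>"] odd odd'
      by (simp only: c' a2' \<beta>2' m_def GL11_simps grassmann_odd_intros)
    finally show ?thesis ..
  qed
  have slide4: "coord_elem (c' e4) = m \<otimes>\<^bsub>GL11 N\<^esub> p \<otimes>\<^bsub>GL11 N\<^esub> coord_elem (c e4)"
  proof -
    define t where "t = 1 - (1/2) *\<^sub>R (b4\<^sup>2 * (\<alpha> * \<beta>4))"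
    have t: "t = 1 - (1/2) *\<^sub>R (b4\<^sup>2 * b5\<^sup>2 * \<alpha>5 * \<beta>4)"
      unfolding t_def \<alpha>_def by (simp add: even_simps)
    have t_pos: "a4 * t \<in> grassmann_pos N"
      unfolding t_def using pos odd odd' by (auto simp: grassmann_pos_def body_odd)
    have a4': "a4' = a4 * t * a5'"
      unfolding a4'_def a5'_def t[symmetric] by (simp only: mult.assoc even_ac(3)[OF even(9)])
    have \<alpha>4': "\<alpha>4' = (inverse b5)\<^sup>2 * (\<alpha>4 + \<alpha>)"
      unfolding \<alpha>4'_def \<alpha>_def i_def[symmetric]
      by (simp add: power2_eq_square distrib_left mult.assoc i_left i(2))
    have "m \<otimes>\<^bsub>GL11 N\<^esub> p \<otimes>\<^bsub>GL11 N\<^esub> coord_elem (c e4) =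
        m \<otimes>\<^bsub>GL11 N\<^esub> (p \<otimes>\<^bsub>GL11 N\<^esub> coord_elem (c e4))"
      using qpm closed[of e4] by (simp add: m_assoc del: GL11_simps)
    also have "\<dots> = m \<otimes>\<^bsub>GL11 N\<^esub> coord_elem (a4 * t, b4, \<alpha>4 + \<alpha>, \<beta>4)"
      using coord_elem_upper_mult[OF pos(8,7) odd(7,8) odd'(1)] by (simp only: coords GL11_simps p_def t_def)
    also have "\<dots> = coord_elem (c' e4)"
      using coord_elem_mult_diag(2)[OF pos(8) t_pos pos(10) a'(5) _ odd(8), of "\<alpha>4 + \<alpha>"] odd odd'
      by (simp only: c' a4' \<alpha>4' m_def GL11_simps grassmann_odd_intros)
    finally show ?thesis ..
  qed
  interpret flip_connection \<tau> \<tau>' ?d1 ?d2 ?d3 ?d4 ?e ?f u v u' v' "GL11 N" ?A ?A'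
  proof
    show "?A' d = ?A d" if "d \<in> oedges \<tau>" "fst d \<notin> R" for d
    proof -
      obtain e b where d: "d = (e, b)" by (cases d)
      then have "e \<in> edges \<tau> - {e1, e2, e3, e4, e5}"
        using that by (auto simp: oedges_def)
      then show ?thesis
        using assms(20) c'_off[of e] unfolding d by simp
    qed
    show "monodromy (GL11 N) ?A' r' = monodromy (GL11 N) ?A r" if "(r, r') \<in> P" for r r'
      using A _ _ _ qpm _ _ _ _ _ _ that
      by (rule passage_monodromies_if_factored)
        (simp_all add: region(2-5) factor slide1 slide2 slide3 slide4 c'(5) m_def)
  qed (fact A)+
  show ?thesis
    using gauge_class_eq_flip_image \<open>c' \<in> coord_vectors N \<tau>'\<close> c' c'_off
    unfolding Let_def \<alpha>_def \<beta>_def \<alpha>4'_def \<beta>2'_def i_def a1'_def a2'_def a3'_def a4'_def a5'_def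
    by (intro bexI[of _ c'] conjI) auto
qed

end
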